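(* Fix an integer $n\ge 2$. Let $(a,b)$ and $(c,d)$ be reflection indices such that $b-a\le n$ and $d-c\le n$. In the FTFSDL factorization $(\twoheadrightarrow,\hookrightarrow,\to)$ of the cyclic Tamari lattice $\mathsf{CTam}=\mathsf{CTam}_{312}$, we have: (i) $j_{a,b}\twoheadleftarrow j_{c,d}$ if and only if the integers $a,b,c,d$ can be chosen so that $a=c$ and $b\le d$; (ii) $j_{a,b}\hookrightarrow j_{c,d}$ if and only if the integers $a,b,c,d$ can be chosen so that $b=d$ and $a\ge c$; (iii) $j_{a,b}\to j_{c,d}$ if and only if the integers $a,b,c,d$ can be chosen so that $c\le a<d\le b$. Furthermore, the restriction of these relations to the join-irreducible elements of the affine Tamari lattice $\mathsf{ATam}=\mathsf{ATam}_{312}$ gives the FTFSDL factorization of $\mathsf{ATam}$.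
   Context: Fix an integer $n\ge 2$. A translation-invariant total order (TITO) is a total order $\preceq$ on $\mathbb Z$ such that $a\preceq b$ iff $a+n\preceq b+n$. A reflection index is a pair $(a,b)$ of integers with $a<b$, considered up to simultaneous translation by multiples of $n$. "The integers $a,b,c,d$ can be chosen so that..." means: there are representatives of the reflection indices $(a,b)$ and $(c,d)$ with the stated property. An inversion of $\preceq$ is a reflection index $(a,b)$ with $b\preceq a$; $\mathrm{Inv}(\preceq)$ is the set of inversions. TITOs are ordered by $\preceq_1\,\le\,\preceq_2$ iff $\mathrm{Inv}(\preceq_1)\subseteq\mathrm{Inv}(\preceq_2)$. A TITO is $312$-avoiding if there are no integers $a<b<c$ with $c\preceq a\preceq b$. A block of a TITO is a nonempty order-convex subset $I\subseteq\mathbb Z$ with no minimal or maximal element in which all intervals between two elements are finite; its size is the number of residue classes modulo $n$ it contains; it is waxing if $x\preceq x+n$ for $x\in I$ and waning otherwise. A TITO is real if every block of size $1$ is waxing. $\mathsf{CTam}_{312}$ (resp. $\mathsf{ATam}_{312}$) is the poset of $312$-avoiding (resp. $312$-avoiding real) TITOs. Both are finite semidistributive lattices. Window notation: $[a_1,\ldots,a_k]$ denotes the block $\cdots\prec a_1\prec\cdots\prec a_k\prec a_1+n\prec\cdots$, and $[\underline{a_1,\ldots,a_k}]$ denotes the block $\cdots\prec a_1\prec\cdots\prec a_k\prec a_1-n\prec\cdots$; a concatenation of windows denotes the TITO whose blocks appear left to right in that order. The join-irreducible elements of $\mathsf{CTam}_{312}$ are the elements $j_{a,b}$ for reflection indices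 $(a,b)$ with $b\le a+n$, where for $b<a+n$, $j_{a,b}=[b+1-n,b+2-n,\ldots,\widehat a,\ldots,b-1,b,a]$ (the entry $a$ is omitted from the increasing list $b+1-n,\ldots,b$ and appended at the end), and for $b=a+n$, $j_{a,b}=[a-n+1,\ldots,a-1][\underline a]$. The join-irreducible elements of $\mathsf{ATam}_{312}$ are the $j_{a,b}$ with $b<a+n$. FTFSDL factorization: for a finite semidistributive lattice $L$, each join-irreducible $j$ covers a unique element $j_*$; let $\kappa(j)=\max\{z\in L\mid z\wedge j=j_*\}$. On the set of join-irreducibles of $L$ define: $j_1\twoheadrightarrow j_2$ (also written $j_2\twoheadleftarrow j_1$) iff $j_1\ge j_2$; $j_1\hookrightarrow j_2$ iff $\kappa(j_1)\ge\kappa(j_2)$; $j_1\to j_2$ iff $j_1\not\le\kappa(j_2)$. The triple $(\twoheadrightarrow,\hookrightarrow,\to)$ is the FTFSDL factorization of $L$. *)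

theory Defs
  imports "HOL-Algebra.Lattice"
begin

section \<open>Translation-invariant total orders\<close>

text \<open>A total order on the integers is a relation \<open>R\<close>, with \<open>(x, y) \<in> R\<close> read as
  \<open>x \<preceq> y\<close>.\<close>

definition tito :: "int \<Rightarrow> int rel \<Rightarrow> bool" where
  "tito n R \<longleftrightarrow>
     linear_order_on UNIV R \<and> (\<forall>a b. (a, b) \<in> R \<longleftrightarrow> (a + n, b + n) \<in> R)"

text \<open>The class of a pair under simultaneous translation by multiples of \<open>n\<close>; it is a
  reflection index when \<open>a < b\<close>. Its members are the representatives.\<close>

definition reflection_index :: "int \<Rightarrow> int \<Rightarrow> int \<Rightarrow> (int \<times> int) set" where
  "reflection_index n a b = {(a + k * n, b + k * n) | k. True}"

definition Inv :: "int \<Rightarrow> int rel \<Rightarrow> (int \<times> int) set set" where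
  "Inv n R = {reflection_index n a b | a b. a < b \<and> (b, a) \<in> R}"

definition avoids_312 :: "int rel \<Rightarrow> bool" where
  "avoids_312 R \<longleftrightarrow> \<not> (\<exists>a b c. a < b \<and> b < c \<and> (c, a) \<in> R \<and> (a, b) \<in> R)"

definition tito_block :: "int rel \<Rightarrow> int set \<Rightarrow> bool" where
  "tito_block R I \<longleftrightarrow>
     I \<noteq> {} \<and>
     (\<forall>x\<in>I. \<forall>y\<in>I. \<forall>z. (x, z) \<in> R \<and> (z, y) \<in> R \<longrightarrow> z \<in> I) \<and>
     \<not> (\<exists>m\<in>I. \<forall>x\<in>I. (m, x) \<in> R) \<and>
     \<not> (\<exists>m\<in>I. \<forall>x\<in>I. (x, m) \<in> R) \<and>
     (\<forall>x\<in>I. \<forall>y\<in>I. finite {z. (x, z) \<in> R \<and> (z, y) \<in> R})"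

definition block_size :: "int \<Rightarrow> int set \<Rightarrow> nat" where
  "block_size n I = card ((\<lambda>x. x mod n) ` I)"

definition waxing :: "int \<Rightarrow> int rel \<Rightarrow> int set \<Rightarrow> bool" where
  "waxing n R I \<longleftrightarrow> (\<forall>x\<in>I. (x, x + n) \<in> R)"

definition real_tito :: "int \<Rightarrow> int rel \<Rightarrow> bool" where
  "real_tito n R \<longleftrightarrow> tito n R \<and>
     (\<forall>I. tito_block R I \<and> block_size n I = 1 \<longrightarrow> waxing n R I)"

definition tito_poset :: "int \<Rightarrow> int rel set \<Rightarrow> int rel gorder" where
  "tito_poset n X = \<lparr>carrier = X, eq = (=), le = (\<lambda>R S. Inv n R \<subseteq> Inv n S)\<rparr>"

definition CTam :: "int \<Rightarrow> int rel gorder" where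
  "CTam n = tito_poset n {R. tito n R \<and> avoids_312 R}"

definition ATam :: "int \<Rightarrow> int rel gorder" where
  "ATam n = tito_poset n {R. real_tito n R \<and> avoids_312 R}"


section \<open>Window notation\<close>

text \<open>\<open>Waning\<close> is the underlined window. The block of a window is enumerated in increasing
  \<open>\<preceq>\<close>-order by \<open>window_seq\<close>, with the window itself at positions \<open>0, \<dots>, k - 1\<close>.\<close>

datatype window = Waxing "int list" | Waning "int list"

fun window_seq :: "int \<Rightarrow> window \<Rightarrow> int \<Rightarrow> int" where
  "window_seq n (Waxing as) i = as ! nat (i mod int (length as)) + n * (i div int (length as))"
| "window_seq n (Waning as) i = as ! nat (i mod int (length as)) - n * (i div int (length as))"

definition tito_of_windows :: "int \<Rightarrow> window list \<Rightarrow> int rel" where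
  "tito_of_windows n ws =
     {(window_seq n (ws ! p) i, window_seq n (ws ! q) j) | p q i j.
        p < length ws \<and> q < length ws \<and> (p < q \<or> p = q \<and> i \<le> j)}"

text \<open>Only meaningful for \<open>a < b \<le> a + n\<close>; the second branch is the case \<open>b = a + n\<close>.\<close>

definition j_elt :: "int \<Rightarrow> int \<Rightarrow> int \<Rightarrow> int rel" where
  "j_elt n a b =
     (if b < a + n
      then tito_of_windows n [Waxing (removeAll a [b + 1 - n..b] @ [a])]
      else tito_of_windows n [Waxing [a - n + 1..a - 1], Waning [a]])"


section \<open>The FTFSDL factorization of a finite semidistributive lattice\<close>

text \<open>The definitions by \<open>THE\<close>, as well as the library's meet and join, describe existing
  elements when \<open>L\<close> is a finite semidistributive lattice and are not used otherwise.\<close>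

definition join_irreducibles :: "'a gorder \<Rightarrow> 'a set" where
  "join_irreducibles L =
     {j \<in> carrier L. \<not> least L j (carrier L) \<and>
        (\<forall>x\<in>carrier L. \<forall>y\<in>carrier L. j = x \<squnion>\<^bsub>L\<^esub> y \<longrightarrow> j = x \<or> j = y)}"

definition covers :: "'a gorder \<Rightarrow> 'a \<Rightarrow> 'a \<Rightarrow> bool" where
  "covers L x y \<longleftrightarrow> x \<in> carrier L \<and> y \<in> carrier L \<and> y \<sqsubset>\<^bsub>L\<^esub> x \<and>
     \<not> (\<exists>z\<in>carrier L. y \<sqsubset>\<^bsub>L\<^esub> z \<and> z \<sqsubset>\<^bsub>L\<^esub> x)"

definition lower_cover :: "'a gorder \<Rightarrow> 'a \<Rightarrow> 'a" where
  "lower_cover L j = (THE x. covers L j x)"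

definition kappa :: "'a gorder \<Rightarrow> 'a \<Rightarrow> 'a" where
  "kappa L j = (THE z. greatest L z {z \<in> carrier L. z \<sqinter>\<^bsub>L\<^esub> j = lower_cover L j})"

text \<open>The relations \<open>\<twoheadrightarrow>\<close>, \<open>\<hookrightarrow>\<close>, \<open>\<rightarrow>\<close> on the set of
  join-irreducible elements.\<close>

definition ftfsdl_onto :: "'a gorder \<Rightarrow> 'a rel" where
  "ftfsdl_onto L = {(j1, j2). j1 \<in> join_irreducibles L \<and> j2 \<in> join_irreducibles L \<and>
     j2 \<sqsubseteq>\<^bsub>L\<^esub> j1}"

definition ftfsdl_into :: "'a gorder \<Rightarrow> 'a rel" where
  "ftfsdl_into L = {(j1, j2). j1 \<in> join_irreducibles L \<and> j2 \<in> join_irreducibles L \<and>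
     kappa L j2 \<sqsubseteq>\<^bsub>L\<^esub> kappa L j1}"

definition ftfsdl_to :: "'a gorder \<Rightarrow> 'a rel" where
  "ftfsdl_to L = {(j1, j2). j1 \<in> join_irreducibles L \<and> j2 \<in> join_irreducibles L \<and>
     \<not> j1 \<sqsubseteq>\<^bsub>L\<^esub> kappa L j2}"

end

theory Submission
  imports Defs
begin

text \<open>
  A total order on the integers is determined by its inversions, the pairs \<open>a < b\<close> with \<open>b\<close>
  before \<open>a\<close>. For a \<open>312\<close>-avoiding translation-invariant order, the entries
  above \<open>a\<close> that precede \<open>a\<close> form an interval starting at \<open>a + 1\<close>; let \<open>m(a)\<close> be its right
  end (\<open>a\<close> if the interval is empty, possibly \<open>\<infinity>\<close>). The orders correspond in this way to the
  translation-invariant bracket functions: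
  \<open>m(a) \<ge> a\<close>, and \<open>a < b \<le> m(a)\<close> implies \<open>m(b) \<le> m(a)\<close>. The order of the lattice is the
  pointwise order of these functions, that is, inclusion of inversion sets
  (\<open>avoiding_titos_eq\<close>, \<open>Inv_subset_iff\<close>), and meets are intersections.

  In this model every notion in the theorem is explicit. The order \<open>j\<^sub>a\<^sub>b\<close> has the least inversion
  set containing \<open>(a, b)\<close> (\<open>j_elt_eq\<close>, \<open>gen_set_least\<close>), and below it there is only a
  chain: \<open>m(a)\<close> is lowered step by step and all else is trivial. An element \<open>z\<close> meets \<open>j\<^sub>a\<^sub>b\<close> in its
  lower cover iff \<open>m(a) = b - 1\<close> for \<open>z\<close>. The bracket condition then forces \<open>m(x) \<le> b - 1\<close> for
  \<open>a \<le> x < b\<close> and nothing else, so the greatest such \<open>z\<close> has \<open>m(x) = b - 1\<close> on the translates of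
  \<open>[a, b - 1]\<close> and \<open>m(x) = \<infinity>\<close> elsewhere; its inversion set is \<open>kappa_set\<close>. All three relations
  are now membership tests. We have \<open>j\<^sub>a\<^sub>b \<le> j\<^sub>c\<^sub>d\<close> iff \<open>(a, b)\<close> lies in the inversion set of
  \<open>j\<^sub>c\<^sub>d\<close>, and \<open>j\<^sub>a\<^sub>b \<le> \<kappa>(j\<^sub>c\<^sub>d)\<close> iff \<open>(a, b)\<close> lies in that of \<open>\<kappa>(j\<^sub>c\<^sub>d)\<close>. Finally
  \<open>\<kappa>(j\<^sub>c\<^sub>d) \<le> \<kappa>(j\<^sub>a\<^sub>b)\<close> iff the inversion set of \<open>\<kappa>(j\<^sub>c\<^sub>d)\<close> misses
  \<open>(b - 1, b)\<close> and \<open>(a, b)\<close>, which pins down the right end \<open>d\<close> and bounds the left end \<open>c\<close>.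

  An order in this lattice is real iff the number of residue classes with \<open>m = \<infinity>\<close> is not one
  (\<open>real_tito_order_of_iff\<close>). Every element has a greatest real element below it, its
  \<open>real_part\<close>, so the real elements are closed under joins, and \<open>\<kappa>\<close> computed among the real
  elements is the real part of the original \<open>\<kappa>\<close>. Real elements are joins of the \<open>j\<^sub>a\<^sub>b\<close> with
  \<open>b < a + n\<close>: an infinite \<open>m(a)\<close> is produced by transitivity out of two different waning
  classes. Passing to real parts affects neither \<open>j\<^sub>a\<^sub>b \<le> \<kappa>(j\<^sub>c\<^sub>d)\<close>, as \<open>j\<^sub>a\<^sub>b\<close> is real, nor
  \<open>\<kappa>(j\<^sub>c\<^sub>d) \<le> \<kappa>(j\<^sub>a\<^sub>b)\<close>, as the two test pairs are shorter than \<open>n\<close>.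
\<close>

section \<open>Orders and their inversion sets\<close>

definition inversions :: "int rel \<Rightarrow> (int \<times> int) set" where
  "inversions R = {(a, b). a < b \<and> (b, a) \<in> R}"

definition order_of :: "(int \<times> int) set \<Rightarrow> int rel" where
  "order_of E = {(x, y). x = y \<or> x < y \<and> (x, y) \<notin> E \<or> y < x \<and> (y, x) \<in> E}"

text \<open>The inversion sets of \<open>312\<close>-avoiding translation-invariant total orders: the third
  condition is the avoidance of \<open>312\<close>, the fourth is transitivity of the order.\<close>

definition tamari_sets :: "int \<Rightarrow> (int \<times> int) set set" where
  "tamari_sets n = {E. (\<forall>a b. (a, b) \<in> E \<longrightarrow> a < b) \<and>
     (\<forall>a b k. (a, b) \<in> E \<longrightarrow> (a + k * n, b + k * n) \<in> E) \<and>
     (\<forall>a b c. a < b \<and> b < c \<and> (a, c) \<in> E \<longrightarrow> (a, b) \<in> E) \<and>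
     (\<forall>a b c. (a, b) \<in> E \<and> (b, c) \<in> E \<longrightarrow> (a, c) \<in> E)}"

lemma tamari_lessD: "E \<in> tamari_sets n \<Longrightarrow> (a, b) \<in> E \<Longrightarrow> a < b"
  unfolding tamari_sets_def by blast

lemma tamari_shift_iff:
  assumes "E \<in> tamari_sets n"
  shows "(a + k * n, b + k * n) \<in> E \<longleftrightarrow> (a, b) \<in> E"
proof
  have *: "\<And>a b k. (a, b) \<in> E \<Longrightarrow> (a + k * n, b + k * n) \<in> E"
    using assms unfolding tamari_sets_def by blast
  show "(a, b) \<in> E" if "(a + k * n, b + k * n) \<in> E"
    using *[OF that, of "-k"] by simp
  show "(a + k * n, b + k * n) \<in> E" if "(a, b) \<in> E"
    using *[OF that] .
qed

lemma tamari_initial: "E \<in> tamari_sets n \<Longrightarrow> (a, c) \<in> E \<Longrightarrow> a < b \<Longrightarrow> b \<le> c \<Longrightarrow> (a, b) \<in> E"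
  unfolding tamari_sets_def by (drule order_le_less[THEN iffD1]) blast

lemma tamari_trans: "E \<in> tamari_sets n \<Longrightarrow> (a, b) \<in> E \<Longrightarrow> (b, c) \<in> E \<Longrightarrow> (a, c) \<in> E"
  unfolding tamari_sets_def by blast

lemma inversions_order_of:
  assumes "E \<in> tamari_sets n"
  shows "inversions (order_of E) = E"
  using tamari_lessD[OF assms] by (auto simp: inversions_def order_of_def)

lemma inj_on_order_of: "inj_on order_of (tamari_sets n)"
  by (rule inj_on_inverseI) (rule inversions_order_of)

lemma linear_order_of:
  assumes E: "E \<in> tamari_sets n"
  shows "linear_order_on UNIV (order_of E)"
proof -
  have "trans (order_of E)"
  proof (rule transI)
    fix x y z assume xy: "(x, y) \<in> order_of E" and yz: "(y, z) \<in> order_of E"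
    note t = tamari_trans[OF E] and i = tamari_initial[OF E]
    consider "x = y \<or> y = z \<or> x = z" | "x < y" "y < z" | "x < z" "z < y" | "y < x" "x < z"
      | "y < z" "z < x" | "z < x" "x < y" | "z < y" "y < x"
      by linarith
    then show "(x, z) \<in> order_of E"
    proof cases
      case 1 then show ?thesis using xy yz by (auto simp: order_of_def)
    next
      case 2 then show ?thesis using xy yz i[of x z y] by (auto simp: order_of_def)
    next
      case 3 then show ?thesis using xy yz t[of x z y] by (auto simp: order_of_def)
    next
      case 4 then show ?thesis using xy yz t[of y x z] by (auto simp: order_of_def)
    next
      case 5 then show ?thesis using xy yz i[of y x z] by (auto simp: order_of_def)
    next
      case 6 then show ?thesis using xy yz i[of z y x] by (auto simp: order_of_def)
    next
      case 7 then show ?thesis using xy yz t[of z y x] by (auto simp: order_of_def)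
    qed
  qed
  then show ?thesis
    by (auto simp: order_on_defs refl_on_def antisym_def total_on_def order_of_def)
qed

lemma tito_shift_iff:
  assumes "tito n R"
  shows "(a + k * n, b + k * n) \<in> R \<longleftrightarrow> (a, b) \<in> R"
proof -
  have step: "(a + n, b + n) \<in> R \<longleftrightarrow> (a, b) \<in> R" for a b
    using assms by (simp add: tito_def)
  show ?thesis
  proof (induction k rule: int_induct[of _ 0])
    case (step1 i)
    then show ?case using step[of "a + i * n" "b + i * n"] by (simp add: algebra_simps)
  next
    case (step2 i)
    then show ?case using step[of "a + (i - 1) * n" "b + (i - 1) * n"] by (simp add: algebra_simps)
  qed simp
qed

lemma order_of_inversions:
  assumes "linear_order_on UNIV R"
  shows "order_of (inversions R) = R"
proof -
  have r: "(x, x) \<in> R" for x using assms by (auto simp: order_on_defs refl_on_def)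
  have a: "(x, y) \<in> R \<Longrightarrow> (y, x) \<in> R \<Longrightarrow> x = y" for x y
    using assms by (auto simp: order_on_defs antisym_def)
  have t: "(x, y) \<in> R \<or> (y, x) \<in> R" for x y
    using assms r by (cases "x = y") (auto simp: order_on_defs total_on_def)
  have "(x, y) \<in> order_of (inversions R) \<longleftrightarrow> (x, y) \<in> R" for x y
    using r[of x] a[of x y] t[of x y]
    by (cases x y rule: linorder_cases) (auto simp: order_of_def inversions_def)
  then show ?thesis by auto
qed

text \<open>Avoiding \<open>312\<close> says that the inversions with a given smaller entry \<open>a\<close> are the
  pairs \<open>(a, b)\<close> with \<open>b\<close> in an initial segment of the integers above \<open>a\<close>. Given this, the order
  is transitive as soon as the inversion set is: of the two conditions on an inversion set, the one
  on its complement comes for free.\<close>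

lemma avoiding_titos_eq: "{R. tito n R \<and> avoids_312 R} = order_of ` tamari_sets n"
proof (intro Set.set_eqI iffI)
  fix R assume "R \<in> {R. tito n R \<and> avoids_312 R}"
  then have R: "tito n R" and av: "avoids_312 R" by auto
  then have lin: "linear_order_on UNIV R" by (simp add: tito_def)
  have tr: "\<And>x y z. (x, y) \<in> R \<Longrightarrow> (y, z) \<in> R \<Longrightarrow> (x, z) \<in> R"
    using lin by (auto simp: order_on_defs dest: transD)
  have tot: "\<And>x y. x \<noteq> y \<Longrightarrow> (x, y) \<in> R \<or> (y, x) \<in> R"
    using lin by (auto simp: order_on_defs total_on_def)
  have "inversions R \<in> tamari_sets n"
    unfolding tamari_sets_def
  proof (intro CollectI conjI allI impI)
    fix a b c assume "a < b \<and> b < c \<and> (a, c) \<in> inversions R"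
    then show "(a, b) \<in> inversions R"
      using av tot[of a b] by (auto simp: inversions_def avoids_312_def)
  next
    fix a b c assume "(a, b) \<in> inversions R \<and> (b, c) \<in> inversions R"
    then show "(a, c) \<in> inversions R" using tr[of c b a] by (auto simp: inversions_def)
  qed (auto simp: inversions_def tito_shift_iff[OF R])
  then show "R \<in> order_of ` tamari_sets n"
    using order_of_inversions[OF lin] by (metis image_eqI)
next
  fix R assume "R \<in> order_of ` tamari_sets n"
  then obtain E where E: "E \<in> tamari_sets n" and R: "R = order_of E" by auto
  have "(a, b) \<in> R \<longleftrightarrow> (a + n, b + n) \<in> R" for a b
    using tamari_shift_iff[OF E, of _ 1] by (simp add: R order_of_def)
  moreover have "avoids_312 R"
    unfolding avoids_312_def
  proof clarify
    fix a b c assume "a < b" "b < c" "(c, a) \<in> R" "(a, b) \<in> R"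
    then show False using tamari_initial[OF E, of a c b] by (auto simp: R order_of_def)
  qed
  ultimately show "R \<in> {R. tito n R \<and> avoids_312 R}"
    using linear_order_of[OF E] by (simp add: R tito_def)
qed

lemma Inv_subset_iff:
  assumes E: "E \<in> tamari_sets n" and F: "F \<in> tamari_sets n"
  shows "Inv n (order_of E) \<subseteq> Inv n (order_of F) \<longleftrightarrow> E \<subseteq> F"
proof -
  have Inv: "Inv n (order_of E) = {reflection_index n a b | a b. (a, b) \<in> E}"
    if "E \<in> tamari_sets n" for E
  proof -
    have "a < b \<and> (b, a) \<in> order_of E \<longleftrightarrow> (a, b) \<in> E" for a b
      using inversions_order_of[OF that] by (auto simp: inversions_def Set.set_eq_iff)
    then show ?thesis by (simp add: Inv_def)
  qed
  have mem: "(a, b) \<in> F" if ab: "reflection_index n a b \<in> Inv n (order_of F)" for a b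
  proof -
    obtain c d where cd: "(c, d) \<in> F" "reflection_index n a b = reflection_index n c d"
      using ab by (auto simp: Inv[OF F])
    have "(a, b) \<in> reflection_index n a b"
      unfolding reflection_index_def by (auto intro: exI[of _ 0])
    then have "(a, b) \<in> reflection_index n c d" using cd(2) by simp
    then obtain k where "a = c + k * n" "b = d + k * n"
      by (auto simp: reflection_index_def)
    then show ?thesis using cd(1) tamari_shift_iff[OF F] by simp
  qed
  have "E \<subseteq> F" if "Inv n (order_of E) \<subseteq> Inv n (order_of F)"
  proof clarify
    fix a b assume "(a, b) \<in> E"
    then have "reflection_index n a b \<in> Inv n (order_of E)" by (auto simp: Inv[OF E])
    then show "(a, b) \<in> F" using that mem by blast
  qed
  moreover have "Inv n (order_of E) \<subseteq> Inv n (order_of F)" if "E \<subseteq> F"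
    using that unfolding Inv[OF E] Inv[OF F] by blast
  ultimately show ?thesis by blast
qed

section \<open>Real orders\<close>

text \<open>A waning residue class is a block of its own exactly when no other class wanes. Indeed, if
  \<open>x\<close> and \<open>y\<close> lie in two different waning classes, then a translate of \<open>y\<close> lies between \<open>x\<close> and
  \<open>x + n\<close> in the order.\<close>

definition real_tamari_sets :: "int \<Rightarrow> (int \<times> int) set set" where
  "real_tamari_sets n = {E \<in> tamari_sets n.
     \<forall>a. (a, a + n) \<in> E \<longrightarrow> (\<exists>x. (x, x + n) \<in> E \<and> (\<forall>k. x \<noteq> a + k * n))}"

context
  fixes n :: int
  assumes n2: "2 \<le> n"
begin

lemma mult_less_imp_step: "k < l \<Longrightarrow> k * n + n \<le> l * n"
  using mult_right_mono[of "k + 1" l n] n2 by (simp add: algebra_simps)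

lemma ex_translate:
  obtains k where "a \<le> x + k * n" "x + k * n < a + n"
proof
  have "x + (- ((x - a) div n)) * n = a + (x - a) mod n"
    by (simp add: minus_div_mult_eq_mod[symmetric])
  then show "a \<le> x + (- ((x - a) div n)) * n" "x + (- ((x - a) div n)) * n < a + n"
    using n2 by auto
qed

text \<open>Chaining \<open>a\<close>, \<open>a + n\<close>, \<open>a + 2 n\<close>, \<open>\<dots>\<close> by transitivity shows that a bracket that
  reaches \<open>a + n\<close> is infinite.\<close>

lemma tamari_waning:
  assumes E: "E \<in> tamari_sets n" and a: "(a, a + n) \<in> E" and "a < y"
  shows "(a, y) \<in> E"
proof -
  have "(a, a + int (Suc m) * n) \<in> E" for m
  proof (induction m)
    case (Suc m)
    have "(a + int (Suc m) * n, a + n + int (Suc m) * n) \<in> E"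
      using a tamari_shift_iff[OF E] by blast
    then have "(a, a + n + int (Suc m) * n) \<in> E"
      using Suc tamari_trans[OF E] by blast
    then show ?case by (simp add: algebra_simps)
  qed (use a in simp)
  then have "(a, a + int (Suc (nat (y - a))) * n) \<in> E" .
  moreover have "(y - a) * 1 \<le> (y - a) * n"
    using n2 \<open>a < y\<close> by (intro mult_left_mono) auto
  then have "y \<le> a + int (Suc (nat (y - a))) * n"
    using n2 \<open>a < y\<close> by (simp add: algebra_simps)
  ultimately show ?thesis using tamari_initial[OF E] \<open>a < y\<close> by blast
qed

lemma real_tito_order_of_iff:
  assumes E: "E \<in> tamari_sets n"
  shows "real_tito n (order_of E) \<longleftrightarrow> E \<in> real_tamari_sets n"
proof
  let ?R = "order_of E"
  have tito: "tito n ?R" using E avoiding_titos_eq[of n] by blast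
  have antisym: "\<And>x y. (x, y) \<in> ?R \<Longrightarrow> (y, x) \<in> ?R \<Longrightarrow> x = y"
    using linear_order_of[OF E] by (auto simp: order_on_defs antisym_def)
  {
    assume real: "real_tito n ?R"
    have "\<exists>x. (x, x + n) \<in> E \<and> (\<forall>k. x \<noteq> a + k * n)" if a: "(a, a + n) \<in> E" for a
    proof (rule ccontr)
      assume "\<nexists>x. (x, x + n) \<in> E \<and> (\<forall>k. x \<noteq> a + k * n)"
      then have others: "\<And>x. (x, x + n) \<in> E \<Longrightarrow> \<exists>k. x = a + k * n" by blast
      \<comment> \<open>The class of \<open>a\<close> is then a waning block of size one.\<close>
      define I where "I = range (\<lambda>k. a + k * n)"
      have wane: "(a + k * n, y) \<in> E" if "a + k * n < y" for k y
      proof -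
        have "(a + k * n, a + k * n + n) \<in> E"
          using a tamari_shift_iff[OF E, of a k "a + n"] by (simp add: algebra_simps)
        then show ?thesis using tamari_waning[OF E] that by blast
      qed
      have le: "z \<le> a + k * n" if "(a + k * n, z) \<in> ?R" for k z
        using that wane[of k z] by (auto simp: order_of_def)
      have ge: "a + k * n \<le> z" if "(z, a + k * n) \<in> ?R" "z \<in> I" for k z
        using that le by (auto simp: I_def)
      have convex: "z \<in> I" if "(a + k * n, z) \<in> ?R" for k z
      proof (cases "z = a + k * n")
        case False
        let ?x = "a + k * n"
        have zx: "(z, ?x) \<in> E" "z < ?x" using that le[OF that] False by (auto simp: order_of_def)
        have "(z, z + n) \<in> E"
        proof (cases "?x < z + n")
          case True
          then show ?thesis using zx wane tamari_trans[OF E] by blast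
        next
          case False
          then show ?thesis using zx n2 tamari_initial[OF E, of z ?x "z + n"] by auto
        qed
        then show ?thesis using others by (auto simp: I_def)
      qed (auto simp: I_def)
      have next_below: "(a + (k + 1) * n, a + k * n) \<in> ?R" for k
        using wane[of k "a + (k + 1) * n"] n2 by (simp add: order_of_def algebra_simps)
      have "tito_block ?R I"
        unfolding tito_block_def
      proof (intro conjI)
        show "I \<noteq> {}" by (simp add: I_def)
        show "\<forall>x\<in>I. \<forall>y\<in>I. \<forall>z. (x, z) \<in> ?R \<and> (z, y) \<in> ?R \<longrightarrow> z \<in> I"
          using convex by (auto simp: I_def)
        show "\<not> (\<exists>m\<in>I. \<forall>x\<in>I. (m, x) \<in> ?R)"
        proof
          assume "\<exists>m\<in>I. \<forall>x\<in>I. (m, x) \<in> ?R"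
          then obtain k where "\<forall>x\<in>I. (a + k * n, x) \<in> ?R" by (auto simp: I_def)
          then have "(a + k * n, a + (k + 1) * n) \<in> ?R" by (auto simp: I_def)
          from antisym[OF this next_below] show False using n2 by (simp add: algebra_simps)
        qed
        show "\<not> (\<exists>m\<in>I. \<forall>x\<in>I. (x, m) \<in> ?R)"
        proof
          assume "\<exists>m\<in>I. \<forall>x\<in>I. (x, m) \<in> ?R"
          then obtain k where "\<forall>x\<in>I. (x, a + k * n) \<in> ?R" by (auto simp: I_def)
          then have "(a + (k - 1) * n, a + k * n) \<in> ?R" by (auto simp: I_def)
          from antisym[OF this] next_below[of "k - 1"] show False using n2 by (simp add: algebra_simps)
        qed
        show "\<forall>x\<in>I. \<forall>y\<in>I. finite {z. (x, z) \<in> ?R \<and> (z, y) \<in> ?R}"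
        proof (intro ballI)
          fix x y assume "x \<in> I" "y \<in> I"
          then have "{z. (x, z) \<in> ?R \<and> (z, y) \<in> ?R} \<subseteq> {y..x}"
            using le ge convex by (auto simp: I_def)
          then show "finite {z. (x, z) \<in> ?R \<and> (z, y) \<in> ?R}"
            by (rule finite_subset) simp
        qed
      qed
      moreover have a_in: "a \<in> I" unfolding I_def by (rule range_eqI[of _ _ 0]) simp
      have "(\<lambda>x. x mod n) ` I \<subseteq> {a mod n}" by (auto simp: I_def)
      then have "(\<lambda>x. x mod n) ` I = {a mod n}" using a_in by blast
      then have "block_size n I = 1" by (simp add: block_size_def)
      ultimately have "waxing n ?R I" using real by (simp add: real_tito_def)
      then have "(a, a + n) \<in> ?R" using a_in by (simp add: waxing_def)
      then show False using a n2 by (auto simp: order_of_def)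
    qed
    then show "E \<in> real_tamari_sets n" using E by (simp add: real_tamari_sets_def)
  }
  assume real: "E \<in> real_tamari_sets n"
  have "(x, x + n) \<in> ?R" if I: "tito_block ?R I" and size: "block_size n I = 1" and x: "x \<in> I" for I x
  proof (rule ccontr)
    assume "(x, x + n) \<notin> ?R"
    then have xE: "(x, x + n) \<in> E" using n2 by (auto simp: order_of_def)
    then obtain y' where y': "(y', y' + n) \<in> E" "\<forall>k. y' \<noteq> x + k * n"
      using real by (auto simp: real_tamari_sets_def)
    \<comment> \<open>A translate of the second waning class lies between \<open>x\<close> and \<open>x + n\<close> in both orders.\<close>
    obtain k where k: "x \<le> y' + k * n" "y' + k * n < x + n" using ex_translate by blast
    define y where "y = y' + k * n"
    have yE: "(y, y + n) \<in> E"
      using y'(1) tamari_shift_iff[OF E, of y' k "y' + n"] by (simp add: y_def algebra_simps)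
    have y_ne: "y \<noteq> x + l * n" for l
      using y'(2)[rule_format, of "l - k"] by (auto simp: y_def algebra_simps)
    have y: "x < y" "y < x + n" using k y_ne[of 0] by (auto simp: y_def)
    have same: "\<exists>l. z = x + l * n" if "z \<in> I" for z
    proof -
      obtain r where "(\<lambda>x. x mod n) ` I = {r}"
        using size unfolding block_size_def by (rule card_1_singletonE)
      then have "u mod n = r" if "u \<in> I" for u using that by (metis imageI singletonD)
      then have "z mod n = x mod n" using that x by simp
      then have "z = x + (z div n - x div n) * n"
        using div_mult_mod_eq[of z n] div_mult_mod_eq[of x n] unfolding left_diff_distrib by linarith
      then show ?thesis by blast
    qed
    have conv: "\<And>u v z. u \<in> I \<Longrightarrow> v \<in> I \<Longrightarrow> (u, z) \<in> ?R \<Longrightarrow> (z, v) \<in> ?R \<Longrightarrow> z \<in> I"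
      using I unfolding tito_block_def by blast
    obtain z where z: "z \<in> I" "(x, z) \<notin> ?R" using I x unfolding tito_block_def by blast
    then obtain l where l: "z = x + l * n" using same by blast
    have "(z, z + n) \<in> E"
      using xE tamari_shift_iff[OF E, of x l "x + n"] by (simp add: l algebra_simps)
    then have "x < z"
      using z(2) tamari_waning[OF E, of z x] by (cases x z rule: linorder_cases) (auto simp: order_of_def)
    have yx: "(y, x) \<in> ?R" using y tamari_waning[OF E xE] by (simp add: order_of_def)
    moreover have "(z, y) \<in> ?R"
    proof -
      have "0 < l" using \<open>x < z\<close> l n2 by (simp add: zero_less_mult_iff)
      then have "x + n \<le> z" using mult_less_imp_step[of 0 l] l by simp
      then show ?thesis using y tamari_waning[OF E yE, of z] by (simp add: order_of_def)
    qed
    ultimately have "y \<in> I" using conv[OF z(1) x] by blast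
    then show False using same y_ne by blast
  qed
  then show "real_tito n ?R" using tito by (auto simp: real_tito_def waxing_def)
qed

lemma real_avoiding_titos_eq: "{R. real_tito n R \<and> avoids_312 R} = order_of ` real_tamari_sets n"
proof -
  have "{R. real_tito n R \<and> avoids_312 R} = {R \<in> order_of ` tamari_sets n. real_tito n R}"
    using avoiding_titos_eq[of n] by (auto simp: real_tito_def)
  also have "\<dots> = order_of ` real_tamari_sets n"
    using real_tito_order_of_iff by (auto simp: real_tamari_sets_def)
  finally show ?thesis .
qed

end

section \<open>Posets of inversion sets\<close>

text \<open>The cyclic and the affine lattice are treated at once as the poset of a family \<open>\<E>\<close> of
  inversion sets. Since meets and joins are chosen by Hilbert's operator, they are identified only
  where the family provides them: meets that are intersections, and joins given explicitly.\<close>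

definition tamari_poset :: "int \<Rightarrow> (int \<times> int) set set \<Rightarrow> int rel gorder" where
  "tamari_poset n \<E> = tito_poset n (order_of ` \<E>)"

definition has_joins :: "'a set set \<Rightarrow> bool" where
  "has_joins \<E> \<longleftrightarrow> (\<forall>E\<in>\<E>. \<forall>F\<in>\<E>. \<exists>U\<in>\<E>. E \<subseteq> U \<and> F \<subseteq> U \<and>
     (\<forall>V\<in>\<E>. E \<subseteq> V \<and> F \<subseteq> V \<longrightarrow> U \<subseteq> V))"

context
  fixes n :: int and \<E> :: "(int \<times> int) set set"
  assumes sub: "\<E> \<subseteq> tamari_sets n"
begin

lemma carrier_tamari_poset: "carrier (tamari_poset n \<E>) = order_of ` \<E>"
  by (simp add: tamari_poset_def tito_poset_def)

lemma le_tamari_poset: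
  assumes "E \<in> \<E>" "F \<in> \<E>"
  shows "order_of E \<sqsubseteq>\<^bsub>tamari_poset n \<E>\<^esub> order_of F \<longleftrightarrow> E \<subseteq> F"
proof -
  have "E \<in> tamari_sets n" "F \<in> tamari_sets n" using assms sub by auto
  then show ?thesis by (simp add: tamari_poset_def tito_poset_def Inv_subset_iff)
qed

lemma order_of_eq_iff:
  assumes "E \<in> \<E>" "F \<in> \<E>"
  shows "order_of E = order_of F \<longleftrightarrow> E = F"
  using inj_on_order_of[of n] assms sub by (meson inj_on_def subsetD)

lemma less_tamari_poset:
  assumes "E \<in> \<E>" "F \<in> \<E>"
  shows "order_of E \<sqsubset>\<^bsub>tamari_poset n \<E>\<^esub> order_of F \<longleftrightarrow> E \<subset> F"
proof -
  have "x .=\<^bsub>tamari_poset n \<E>\<^esub> y \<longleftrightarrow> x = y" for x y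
    by (simp add: tamari_poset_def tito_poset_def)
  then show ?thesis
    using le_tamari_poset[OF assms] order_of_eq_iff[OF assms] by (auto simp: lless_def)
qed

lemma least_image_iff:
  assumes "U \<in> \<E>" "P U" and min: "\<And>V. V \<in> \<E> \<Longrightarrow> P V \<Longrightarrow> U \<subseteq> V"
  shows "least (tamari_poset n \<E>) x (order_of ` {V \<in> \<E>. P V}) \<longleftrightarrow> x = order_of U"
proof
  assume x: "least (tamari_poset n \<E>) x (order_of ` {V \<in> \<E>. P V})"
  then obtain V where V: "V \<in> \<E>" "P V" "x = order_of V" by (auto simp: least_def)
  have "V \<subseteq> U" using x V assms(1,2) by (auto simp: least_def le_tamari_poset)
  then have "V = U" using min[OF V(1,2)] by blast
  then show "x = order_of U" using V by simp
qed (use assms in \<open>auto simp: least_def carrier_tamari_poset le_tamari_poset\<close>)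

lemma greatest_image_iff:
  assumes "U \<in> \<E>" "P U" and max: "\<And>V. V \<in> \<E> \<Longrightarrow> P V \<Longrightarrow> V \<subseteq> U"
  shows "greatest (tamari_poset n \<E>) x (order_of ` {V \<in> \<E>. P V}) \<longleftrightarrow> x = order_of U"
proof
  assume x: "greatest (tamari_poset n \<E>) x (order_of ` {V \<in> \<E>. P V})"
  then obtain V where V: "V \<in> \<E>" "P V" "x = order_of V" by (auto simp: greatest_def)
  have "U \<subseteq> V" using x V assms(1,2) by (auto simp: greatest_def le_tamari_poset)
  then have "V = U" using max[OF V(1,2)] by blast
  then show "x = order_of U" using V by simp
qed (use assms in \<open>auto simp: greatest_def carrier_tamari_poset le_tamari_poset\<close>)

lemma join_tamari_poset:
  assumes "E \<in> \<E>" "F \<in> \<E>" "U \<in> \<E>" "E \<subseteq> U" "F \<subseteq> U"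
    and "\<And>V. V \<in> \<E> \<Longrightarrow> E \<subseteq> V \<Longrightarrow> F \<subseteq> V \<Longrightarrow> U \<subseteq> V"
  shows "order_of E \<squnion>\<^bsub>tamari_poset n \<E>\<^esub> order_of F = order_of U"
proof -
  have U: "Upper (tamari_poset n \<E>) {order_of E, order_of F} =
      order_of ` {V \<in> \<E>. E \<subseteq> V \<and> F \<subseteq> V}"
    using assms(1,2) by (auto simp: Upper_def carrier_tamari_poset le_tamari_poset)
  have "least (tamari_poset n \<E>) x (Upper (tamari_poset n \<E>) {order_of E, order_of F})
      \<longleftrightarrow> x = order_of U" for x
    unfolding U by (rule least_image_iff) (use assms in auto)
  then show ?thesis by (simp add: join_def sup_def)
qed

lemma meet_tamari_poset:
  assumes "E \<in> \<E>" "F \<in> \<E>" "E \<inter> F \<in> \<E>"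
  shows "order_of E \<sqinter>\<^bsub>tamari_poset n \<E>\<^esub> order_of F = order_of (E \<inter> F)"
proof -
  have L: "Lower (tamari_poset n \<E>) {order_of E, order_of F} =
      order_of ` {V \<in> \<E>. V \<subseteq> E \<and> V \<subseteq> F}"
    using assms(1,2) by (auto simp: Lower_def carrier_tamari_poset le_tamari_poset)
  have "greatest (tamari_poset n \<E>) x (Lower (tamari_poset n \<E>) {order_of E, order_of F})
      \<longleftrightarrow> x = order_of (E \<inter> F)" for x
    unfolding L by (rule greatest_image_iff) (use assms in auto)
  then show ?thesis by (simp add: meet_def inf_def)
qed

lemma join_irreducible_if_lower_cover:
  assumes joins: "has_joins \<E>" and J: "J \<in> \<E>" "J' \<in> \<E>" "J' \<subset> J"
    and below: "\<And>E. E \<in> \<E> \<Longrightarrow> E \<subset> J \<Longrightarrow> E \<subseteq> J'"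
  shows "order_of J \<in> join_irreducibles (tamari_poset n \<E>)"
  unfolding join_irreducibles_def
proof (intro CollectI conjI ballI impI)
  let ?L = "tamari_poset n \<E>"
  show "order_of J \<in> carrier ?L" using J by (simp add: carrier_tamari_poset)
  show "\<not> least ?L (order_of J) (carrier ?L)"
    using J le_tamari_poset[of J J'] by (auto simp: least_def carrier_tamari_poset)
  fix x y assume "x \<in> carrier ?L" "y \<in> carrier ?L" and xy: "order_of J = x \<squnion>\<^bsub>?L\<^esub> y"
  then obtain E F where EF: "E \<in> \<E>" "F \<in> \<E>" "x = order_of E" "y = order_of F"
    by (auto simp: carrier_tamari_poset)
  then obtain U where U: "U \<in> \<E>" "E \<subseteq> U" "F \<subseteq> U"
      "\<And>V. V \<in> \<E> \<Longrightarrow> E \<subseteq> V \<Longrightarrow> F \<subseteq> V \<Longrightarrow> U \<subseteq> V"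
    using joins unfolding has_joins_def by metis
  have "U = J"
    using join_tamari_poset[OF EF(1,2) U] xy EF order_of_eq_iff U(1) J(1) by metis
  then show "order_of J = x \<or> order_of J = y"
    using U EF J below[of E] below[of F] by blast
qed

text \<open>A join-irreducible that is the join of a finite set of elements is one of them. The least
  upper bound of any finite subset is built up by binary joins, and membership of a join-irreducible
  bound in the subset survives each step, because a join-irreducible join equals one of its arguments; the empty join is the
  bottom element, which is not join-irreducible.\<close>

lemma join_irreducible_in_generators:
  assumes joins: "has_joins \<E>" and bot: "{} \<in> \<E>" and fin: "finite \<G>" and \<G>: "\<G> \<subseteq> \<E>"
    and E: "E \<in> \<E>" "order_of E \<in> join_irreducibles (tamari_poset n \<E>)"
    and gen: "\<And>V. V \<in> \<E> \<Longrightarrow> (\<And>G. G \<in> \<G> \<Longrightarrow> G \<subseteq> E \<Longrightarrow> G \<subseteq> V) \<Longrightarrow> E \<subseteq> V"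
  shows "E \<in> \<G>"
proof -
  let ?L = "tamari_poset n \<E>"
  have *: "\<exists>U\<in>\<E>. (\<forall>G\<in>S. G \<subseteq> U) \<and> (\<forall>V\<in>\<E>. (\<forall>G\<in>S. G \<subseteq> V) \<longrightarrow> U \<subseteq> V) \<and>
      (order_of U \<in> join_irreducibles ?L \<longrightarrow> U \<in> S)" if "finite S" "S \<subseteq> \<E>" for S
    using that
  proof (induction S rule: finite_induct)
    case empty
    have "least ?L (order_of {}) (carrier ?L)"
      using bot by (auto simp: least_def carrier_tamari_poset le_tamari_poset)
    then have "order_of {} \<notin> join_irreducibles ?L" by (simp add: join_irreducibles_def)
    then show ?case using bot by (intro bexI[of _ "{}"]) auto
  next
    case (insert G S)
    then obtain U where U: "U \<in> \<E>" "\<forall>G\<in>S. G \<subseteq> U" "\<forall>V\<in>\<E>. (\<forall>G\<in>S. G \<subseteq> V) \<longrightarrow> U \<subseteq> V"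
        "order_of U \<in> join_irreducibles ?L \<longrightarrow> U \<in> S"
      by auto
    have G: "G \<in> \<E>" using insert.prems by simp
    then obtain W where W: "W \<in> \<E>" "G \<subseteq> W" "U \<subseteq> W"
        "\<And>V. V \<in> \<E> \<Longrightarrow> G \<subseteq> V \<Longrightarrow> U \<subseteq> V \<Longrightarrow> W \<subseteq> V"
      using joins U(1) unfolding has_joins_def by metis
    have "order_of W = order_of G \<squnion>\<^bsub>?L\<^esub> order_of U"
      using join_tamari_poset[OF G U(1) W] by simp
    then have "order_of W = order_of G \<or> order_of W = order_of U"
      if "order_of W \<in> join_irreducibles ?L"
      using that G U(1) unfolding join_irreducibles_def carrier_tamari_poset by blast
    then have "W = G \<or> W = U" if "order_of W \<in> join_irreducibles ?L"
      using that G U(1) W(1) order_of_eq_iff by blast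
    then have "order_of W \<in> join_irreducibles ?L \<longrightarrow> W \<in> insert G S" using U(4) by blast
    moreover have "\<forall>V\<in>\<E>. (\<forall>H\<in>insert G S. H \<subseteq> V) \<longrightarrow> W \<subseteq> V"
    proof (intro ballI impI)
      fix V assume "V \<in> \<E>" "\<forall>H\<in>insert G S. H \<subseteq> V"
      then show "W \<subseteq> V" using U(3) by (intro W(4)) auto
    qed
    moreover have "\<forall>H\<in>insert G S. H \<subseteq> W" using U(2) W(2,3) by blast
    ultimately show ?case using W(1) by (intro bexI[of _ W] conjI)
  qed
  have "finite {G \<in> \<G>. G \<subseteq> E}" "{G \<in> \<G>. G \<subseteq> E} \<subseteq> \<E>" using fin \<G> by auto
  from *[OF this] obtain U where U: "U \<in> \<E>" "\<forall>G\<in>{G \<in> \<G>. G \<subseteq> E}. G \<subseteq> U"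
      "\<forall>V\<in>\<E>. (\<forall>G\<in>{G \<in> \<G>. G \<subseteq> E}. G \<subseteq> V) \<longrightarrow> U \<subseteq> V"
      "order_of U \<in> join_irreducibles ?L \<longrightarrow> U \<in> {G \<in> \<G>. G \<subseteq> E}"
    by blast
  have "U \<subseteq> E" using U(3) E(1) by blast
  moreover have "E \<subseteq> U" using gen[OF U(1)] U(2) by blast
  ultimately have "U = E" by blast
  then show ?thesis using U(4) E(2) by simp
qed

lemma kappa_tamari_poset:
  assumes J: "J \<in> \<E>" "J' \<in> \<E>" "J' \<subset> J"
    and below: "\<And>E. E \<in> \<E> \<Longrightarrow> E \<subset> J \<Longrightarrow> E \<subseteq> J'"
    and meets: "\<And>E. E \<in> \<E> \<Longrightarrow> E \<inter> J \<in> \<E>"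
    and K: "K \<in> \<E>" "K \<inter> J = J'"
    and max: "\<And>E. E \<in> \<E> \<Longrightarrow> E \<inter> J = J' \<Longrightarrow> E \<subseteq> K"
  shows "kappa (tamari_poset n \<E>) (order_of J) = order_of K"
proof -
  let ?L = "tamari_poset n \<E>"
  have covers: "covers ?L (order_of J) x \<longleftrightarrow> x = order_of J'" for x
  proof
    assume x: "covers ?L (order_of J) x"
    then obtain E where E: "E \<in> \<E>" "x = order_of E" by (auto simp: covers_def carrier_tamari_poset)
    then have EJ: "E \<subset> J" using x J by (auto simp: covers_def less_tamari_poset)
    have "\<not> E \<subset> J'"
    proof
      assume "E \<subset> J'"
      then have "x \<sqsubset>\<^bsub>?L\<^esub> order_of J'" "order_of J' \<sqsubset>\<^bsub>?L\<^esub> order_of J"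
        using E J by (simp_all add: less_tamari_poset)
      then show False using x J(2) unfolding covers_def carrier_tamari_poset by blast
    qed
    then have "E = J'" using below[OF E(1) EJ] by blast
    then show "x = order_of J'" using E by simp
  next
    assume x: "x = order_of J'"
    have "\<not> (J' \<subset> E \<and> E \<subset> J)" if "E \<in> \<E>" for E using below[OF that] by blast
    then show "covers ?L (order_of J) x"
      using J by (simp add: x covers_def carrier_tamari_poset less_tamari_poset)
  qed
  have "{z \<in> carrier ?L. z \<sqinter>\<^bsub>?L\<^esub> order_of J = order_of J'} = order_of ` {E \<in> \<E>. E \<inter> J = J'}"
    using J meets by (auto simp: carrier_tamari_poset meet_tamari_poset order_of_eq_iff)
  then have "greatest ?L z {z \<in> carrier ?L. z \<sqinter>\<^bsub>?L\<^esub> order_of J = order_of J'} \<longleftrightarrow> z = order_of K" for z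
    using greatest_image_iff[of K "\<lambda>E. E \<inter> J = J'" z] K max by simp
  then show ?thesis by (simp add: kappa_def lower_cover_def covers)
qed

end

lemma CTam_eq: "CTam n = tamari_poset n (tamari_sets n)"
  by (simp add: CTam_def tamari_poset_def avoiding_titos_eq)

lemma ATam_eq: "2 \<le> n \<Longrightarrow> ATam n = tamari_poset n (real_tamari_sets n)"
  by (simp add: ATam_def tamari_poset_def real_avoiding_titos_eq)

section \<open>Generators, their lower covers and their images under kappa\<close>

text \<open>For \<open>a < b \<le> a + n\<close>, the inversion set generated by \<open>(a, b)\<close>. In the case \<open>b = a + n\<close> transitivity makes the
  bracket at \<open>a\<close> infinite.\<close>

definition gen_set :: "int \<Rightarrow> int \<Rightarrow> int \<Rightarrow> (int \<times> int) set" where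
  "gen_set n a b = {(x, y). x < y \<and> (\<exists>k. x = a + k * n \<and> (y \<le> b + k * n \<or> b = a + n))}"

text \<open>The generator with its right end lowered by one; for \<open>b = a + n\<close> this also makes the
  bracket finite.\<close>

definition gen_cover_set :: "int \<Rightarrow> int \<Rightarrow> int \<Rightarrow> (int \<times> int) set" where
  "gen_cover_set n a b = {(x, y). x < y \<and> (\<exists>k. x = a + k * n \<and> y < b + k * n)}"

text \<open>For \<open>a < b \<le> a + n\<close>, the bracket function is \<open>b - 1\<close> on the interval from \<open>a\<close> to \<open>b - 1\<close>, likewise on its
  translates, and infinite elsewhere.\<close>

definition kappa_set :: "int \<Rightarrow> int \<Rightarrow> int \<Rightarrow> (int \<times> int) set" where
  "kappa_set n a b = {(x, y). x < y \<and> (\<nexists>k. a + k * n \<le> x \<and> x < b + k * n \<and> b + k * n \<le> y)}"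

text \<open>If exactly one residue class wanes, its bracket is cut back to length \<open>n - 1\<close>; otherwise
  nothing changes.\<close>

definition real_part :: "int \<Rightarrow> (int \<times> int) set \<Rightarrow> (int \<times> int) set" where
  "real_part n E = {(x, y) \<in> E. y < x + n \<or> (\<exists>z. (z, z + n) \<in> E \<and> (\<forall>k. z \<noteq> x + k * n))}"

lemma tamari_setsI:
  assumes "\<And>a b. (a, b) \<in> E \<Longrightarrow> a < b"
    and "\<And>a b k. (a, b) \<in> E \<Longrightarrow> (a + k * n, b + k * n) \<in> E"
    and "\<And>a b c. a < b \<Longrightarrow> b < c \<Longrightarrow> (a, c) \<in> E \<Longrightarrow> (a, b) \<in> E"
    and "\<And>a b c. (a, b) \<in> E \<Longrightarrow> (b, c) \<in> E \<Longrightarrow> (a, c) \<in> E"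
  shows "E \<in> tamari_sets n"
  unfolding tamari_sets_def using assms by blast

lemma real_tamariD: "E \<in> real_tamari_sets n \<Longrightarrow> E \<in> tamari_sets n"
  by (simp add: real_tamari_sets_def)

lemma tamari_Inter:
  assumes "S \<subseteq> tamari_sets n" "S \<noteq> {}"
  shows "\<Inter>S \<in> tamari_sets n"
proof (rule tamari_setsI)
  have S: "E \<in> tamari_sets n" if "E \<in> S" for E using that assms by blast
  show "a < b" if "(a, b) \<in> \<Inter>S" for a b using that assms(2) tamari_lessD[OF S] by blast
  show "(a + k * n, b + k * n) \<in> \<Inter>S" if "(a, b) \<in> \<Inter>S" for a b k
    using that tamari_shift_iff[OF S] by blast
  show "(a, b) \<in> \<Inter>S" if "a < b" "b < c" "(a, c) \<in> \<Inter>S" for a b c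
    using that tamari_initial[OF S, of _ a c b] by auto
  show "(a, c) \<in> \<Inter>S" if "(a, b) \<in> \<Inter>S" "(b, c) \<in> \<Inter>S" for a b c
    using that tamari_trans[OF S] by blast
qed

lemma tamari_Int: "E \<in> tamari_sets n \<Longrightarrow> F \<in> tamari_sets n \<Longrightarrow> E \<inter> F \<in> tamari_sets n"
  using tamari_Inter[of "{E, F}" n] by simp

text \<open>Inversion sets are closed under intersection and there is a greatest one, so the
  intersection of all upper bounds is a join.\<close>

lemma has_joins_tamari_sets: "has_joins (tamari_sets n)"
  unfolding has_joins_def
proof (intro ballI)
  fix E F assume EF: "E \<in> tamari_sets n" "F \<in> tamari_sets n"
  let ?S = "{V \<in> tamari_sets n. E \<subseteq> V \<and> F \<subseteq> V}"
  have "{(x, y). x < y} \<in> tamari_sets n" by (rule tamari_setsI) auto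
  then have "{(x, y). x < y} \<in> ?S" using tamari_lessD[OF EF(1)] tamari_lessD[OF EF(2)] by auto
  then have "\<Inter>?S \<in> tamari_sets n" by (intro tamari_Inter) auto
  then show "\<exists>U\<in>tamari_sets n. E \<subseteq> U \<and> F \<subseteq> U \<and>
      (\<forall>V\<in>tamari_sets n. E \<subseteq> V \<and> F \<subseteq> V \<longrightarrow> U \<subseteq> V)"
    by (intro bexI[of _ "\<Inter>?S"]) auto
qed

lemma real_part_subset: "real_part n E \<subseteq> E"
  by (auto simp: real_part_def)

lemma real_part_mono: "E \<subseteq> F \<Longrightarrow> real_part n E \<subseteq> real_part n F"
  by (auto simp: real_part_def)

lemma empty_real_tamari: "{} \<in> real_tamari_sets n"
  by (auto simp: real_tamari_sets_def intro: tamari_setsI)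

lemma kappa_set_tamari: "kappa_set n a b \<in> tamari_sets n"
proof (rule tamari_setsI)
  show "(x + k * n, y + k * n) \<in> kappa_set n a b" if xy: "(x, y) \<in> kappa_set n a b" for x y k
  proof -
    have "\<not> (a + l * n \<le> x + k * n \<and> x + k * n < b + l * n \<and> b + l * n \<le> y + k * n)" for l
    proof -
      have "\<not> (a + (l - k) * n \<le> x \<and> x < b + (l - k) * n \<and> b + (l - k) * n \<le> y)"
        using xy unfolding kappa_set_def by blast
      then show ?thesis by (simp add: algebra_simps)
    qed
    then show ?thesis using xy by (simp add: kappa_set_def)
  qed
  show "(x, z) \<in> kappa_set n a b" if xy: "(x, y) \<in> kappa_set n a b" and yz: "(y, z) \<in> kappa_set n a b" for x y z
  proof -
    have less: "x < y" "y < z" using xy yz by (auto simp: kappa_set_def)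
    have "\<not> (a + k * n \<le> x \<and> x < b + k * n \<and> b + k * n \<le> z)" for k
    proof -
      have "\<not> (a + k * n \<le> x \<and> x < b + k * n \<and> b + k * n \<le> y)"
        using xy unfolding kappa_set_def by blast
      moreover have "\<not> (a + k * n \<le> y \<and> y < b + k * n \<and> b + k * n \<le> z)"
        using yz unfolding kappa_set_def by blast
      ultimately show ?thesis using less by linarith
    qed
    then show ?thesis using less by (simp add: kappa_set_def)
  qed
  show "(x, y) \<in> kappa_set n a b" if "x < y" "y < z" "(x, z) \<in> kappa_set n a b" for x y z
    using that unfolding kappa_set_def by auto
qed (auto simp: kappa_set_def)

context
  fixes n :: int
  assumes n2: "2 \<le> n"
begin

lemmas step = mult_less_imp_step[OF n2]

lemma small_multiple: "- n < k * n \<Longrightarrow> k * n < n \<Longrightarrow> k = 0"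
proof (rule ccontr)
  assume k: "- n < k * n" "k * n < n" "k \<noteq> 0"
  then consider "k < 0" | "0 < k" by linarith
  then show False
  proof cases
    case 1
    then have "k * n + n \<le> 0" using step[of k 0] by simp
    then show False using k by linarith
  next
    case 2
    then have "n \<le> k * n" using step[of 0 k] by simp
    then show False using k by linarith
  qed
qed

lemma real_part_ident:
  assumes "E \<in> real_tamari_sets n"
  shows "real_part n E = E"
proof -
  have E: "E \<in> tamari_sets n" using assms by (rule real_tamariD)
  have "(x, y) \<in> real_part n E" if xy: "(x, y) \<in> E" for x y
  proof (cases "y < x + n")
    case False
    then have "(x, x + n) \<in> E" using tamari_initial[OF E xy, of "x + n"] n2 by simp
    then show ?thesis using assms xy by (auto simp: real_tamari_sets_def real_part_def)
  qed (use xy in \<open>simp add: real_part_def\<close>)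
  then show ?thesis using real_part_subset by fastforce
qed

lemma real_part_greatest: "F \<in> real_tamari_sets n \<Longrightarrow> F \<subseteq> E \<Longrightarrow> F \<subseteq> real_part n E"
  using real_part_mono[of F E n] by (simp add: real_part_ident)

text \<open>The delicate point is transitivity. If \<open>(a, b)\<close> and \<open>(b, c)\<close> are kept with
  \<open>b < a + n \<le> c\<close>, then \<open>b\<close> wanes together with \<open>a\<close>, so \<open>(a, c)\<close> is not cut off.\<close>

lemma real_part_real:
  assumes E: "E \<in> tamari_sets n"
  shows "real_part n E \<in> real_tamari_sets n"
proof -
  note shift = tamari_shift_iff[OF E]
  have "real_part n E \<in> tamari_sets n"
  proof (rule tamari_setsI)
    show "a < b" if "(a, b) \<in> real_part n E" for a b
      using that tamari_lessD[OF E] by (auto simp: real_part_def)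
    show "(a + k * n, b + k * n) \<in> real_part n E" if ab: "(a, b) \<in> real_part n E" for a b k
    proof -
      have E': "(a + k * n, b + k * n) \<in> E" using ab shift by (simp add: real_part_def)
      show ?thesis
      proof (cases "b < a + n")
        case False
        then obtain z where z: "(z, z + n) \<in> E" "\<forall>l. z \<noteq> a + l * n"
          using ab by (auto simp: real_part_def)
        have "z \<noteq> a + k * n + l * n" for l
          using z(2)[rule_format, of "k + l"] by (simp add: algebra_simps)
        then show ?thesis using E' z(1) unfolding real_part_def by blast
      qed (use E' in \<open>simp add: real_part_def\<close>)
    qed
    show "(a, b) \<in> real_part n E" if "a < b" "b < c" "(a, c) \<in> real_part n E" for a b c
      using that tamari_initial[OF E, of a c b] by (auto simp: real_part_def)
    show "(a, c) \<in> real_part n E" if ab: "(a, b) \<in> real_part n E" and bc: "(b, c) \<in> real_part n E" for a b c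
    proof -
      have E': "(a, b) \<in> E" "(b, c) \<in> E" "(a, c) \<in> E"
        using ab bc tamari_trans[OF E, of a b c] by (auto simp: real_part_def)
      show ?thesis
      proof (cases "c < a + n \<or> \<not> b < a + n")
        case True
        then show ?thesis using E' ab by (auto simp: real_part_def)
      next
        case False
        have lt: "a < b" using E' tamari_lessD[OF E] by blast
        have "(a, a + n) \<in> E" using tamari_initial[OF E E'(3), of "a + n"] False n2 by simp
        then have "(a + n, b + n) \<in> E"
          using shift[of a 1 b] E'(1) by simp
        moreover have "(b, a + n) \<in> E" using tamari_initial[OF E E'(2)] False by simp
        ultimately have "(b, b + n) \<in> E" using tamari_trans[OF E] by blast
        moreover have "b \<noteq> a + k * n" for k
        proof
          assume b: "b = a + k * n"
          have "k = 0" by (rule small_multiple) (use b lt False n2 in linarith)+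
          then show False using b lt by simp
        qed
        ultimately show ?thesis using E' by (auto simp: real_part_def)
      qed
    qed
  qed
  moreover have "\<exists>x. (x, x + n) \<in> real_part n E \<and> (\<forall>k. x \<noteq> a + k * n)"
    if a: "(a, a + n) \<in> real_part n E" for a
  proof -
    obtain z where z: "(z, z + n) \<in> E" "\<forall>k. z \<noteq> a + k * n" using a by (auto simp: real_part_def)
    have "a \<noteq> z + k * n" for k using z(2)[rule_format, of "-k"] by auto
    then have "(z, z + n) \<in> real_part n E" using z a by (auto simp: real_part_def)
    then show ?thesis using z by blast
  qed
  ultimately show ?thesis by (auto simp: real_tamari_sets_def)
qed

text \<open>The join of two real elements lies above both, hence so does its real part; thus the join
  is real.\<close>

lemma has_joins_real_tamari_sets: "has_joins (real_tamari_sets n)"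
  unfolding has_joins_def
proof (intro ballI)
  fix E F assume EF: "E \<in> real_tamari_sets n" "F \<in> real_tamari_sets n"
  then obtain U where U: "U \<in> tamari_sets n" "E \<subseteq> U" "F \<subseteq> U"
      "\<forall>V\<in>tamari_sets n. E \<subseteq> V \<and> F \<subseteq> V \<longrightarrow> U \<subseteq> V"
    using has_joins_tamari_sets[of n] real_tamariD unfolding has_joins_def by metis
  have "E \<subseteq> real_part n U" "F \<subseteq> real_part n U" using real_part_greatest EF U by auto
  then show "\<exists>U\<in>real_tamari_sets n. E \<subseteq> U \<and> F \<subseteq> U \<and>
      (\<forall>V\<in>real_tamari_sets n. E \<subseteq> V \<and> F \<subseteq> V \<longrightarrow> U \<subseteq> V)"
    using U real_part_real[OF U(1)] real_part_subset[of n U] real_tamariD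
    by (intro bexI[of _ "real_part n U"]) blast+
qed

context
  fixes a b :: int
  assumes ab: "a < b" "b \<le> a + n"
begin

lemma gen_set_tamari: "gen_set n a b \<in> tamari_sets n"
proof (rule tamari_setsI)
  show "(x + k * n, y + k * n) \<in> gen_set n a b" if xy: "(x, y) \<in> gen_set n a b" for x y k
  proof -
    obtain l where "x < y" "x = a + l * n" "y \<le> b + l * n \<or> b = a + n"
      using xy by (auto simp: gen_set_def)
    then show ?thesis by (auto simp: gen_set_def algebra_simps intro!: exI[of _ "l + k"])
  qed
  show "(x, z) \<in> gen_set n a b" if xy: "(x, y) \<in> gen_set n a b" and yz: "(y, z) \<in> gen_set n a b" for x y z
  proof -
    obtain k where k: "x < y" "x = a + k * n" "y \<le> b + k * n \<or> b = a + n"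
      using xy by (auto simp: gen_set_def)
    obtain l where l: "y < z" "y = a + l * n" using yz by (auto simp: gen_set_def)
    have "k * n < l * n" using k l by simp
    then have "k < l" using n2 by (simp add: mult_less_cancel_right)
    then have "b = a + n" using step[of k l] k l ab by auto
    then show ?thesis using k l by (auto simp: gen_set_def)
  qed
qed (auto simp: gen_set_def)

lemma gen_cover_set_tamari: "gen_cover_set n a b \<in> tamari_sets n"
proof (rule tamari_setsI)
  show "(x + k * n, y + k * n) \<in> gen_cover_set n a b" if xy: "(x, y) \<in> gen_cover_set n a b" for x y k
  proof -
    obtain l where "x < y" "x = a + l * n" "y < b + l * n"
      using xy by (auto simp: gen_cover_set_def)
    then show ?thesis by (auto simp: gen_cover_set_def algebra_simps intro!: exI[of _ "l + k"])
  qed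
  show "(x, z) \<in> gen_cover_set n a b"
    if xy: "(x, y) \<in> gen_cover_set n a b" and yz: "(y, z) \<in> gen_cover_set n a b" for x y z
  proof -
    obtain k where k: "x < y" "x = a + k * n" "y < b + k * n"
      using xy by (auto simp: gen_cover_set_def)
    obtain l where l: "y < z" "y = a + l * n" using yz by (auto simp: gen_cover_set_def)
    have "k * n < l * n" using k l by simp
    then have "k < l" using n2 by (simp add: mult_less_cancel_right)
    then show ?thesis using step[of k l] k l ab by auto
  qed
qed (auto simp: gen_cover_set_def)

lemma gen_set_self: "(a, b) \<in> gen_set n a b"
  using ab by (auto simp: gen_set_def intro: exI[of _ 0])

lemma gen_set_least:
  assumes E: "E \<in> tamari_sets n" and abE: "(a, b) \<in> E"
  shows "gen_set n a b \<subseteq> E"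
proof clarify
  fix x y assume "(x, y) \<in> gen_set n a b"
  then obtain k where k: "x < y" "x = a + k * n" "y \<le> b + k * n \<or> b = a + n"
    by (auto simp: gen_set_def)
  have x: "(x, b + k * n) \<in> E" using abE tamari_shift_iff[OF E] by (simp add: k(2))
  show "(x, y) \<in> E"
  proof (cases "y \<le> b + k * n")
    case True
    then show ?thesis using tamari_initial[OF E x] k by blast
  next
    case False
    then have "(x, x + n) \<in> E" using x k by (simp add: algebra_simps)
    then show ?thesis using tamari_waning[OF n2 E] k by blast
  qed
qed

lemma gen_set_subset_iff: "E \<in> tamari_sets n \<Longrightarrow> gen_set n a b \<subseteq> E \<longleftrightarrow> (a, b) \<in> E"
  using gen_set_least gen_set_self by blast

lemma gen_cover_set_psubset: "gen_cover_set n a b \<subset> gen_set n a b"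
proof -
  have "(a, b) \<notin> gen_cover_set n a b" by (auto simp: gen_cover_set_def)
  moreover have "gen_cover_set n a b \<subseteq> gen_set n a b"
    by (auto simp: gen_cover_set_def gen_set_def)
  ultimately show ?thesis using gen_set_self by blast
qed

lemma below_gen_set:
  assumes E: "E \<in> tamari_sets n" and sub: "E \<subset> gen_set n a b"
  shows "E \<subseteq> gen_cover_set n a b"
proof clarify
  fix x y assume xy: "(x, y) \<in> E"
  then have "(x, y) \<in> gen_set n a b" using sub by blast
  then obtain k where k: "x < y" "x = a + k * n" by (auto simp: gen_set_def)
  have "\<not> b + k * n \<le> y"
  proof
    assume "b + k * n \<le> y"
    then have "(a + k * n, b + k * n) \<in> E" using tamari_initial[OF E xy, of "b + k * n"] k ab by simp
    then have "(a, b) \<in> E" using tamari_shift_iff[OF E] by blast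
    then show False using gen_set_least[OF E] sub by blast
  qed
  then show "(x, y) \<in> gen_cover_set n a b" using k by (auto simp: gen_cover_set_def)
qed

lemma kappa_set_Int: "kappa_set n a b \<inter> gen_set n a b = gen_cover_set n a b"
proof (intro equalityI subsetI)
  fix p assume p: "p \<in> kappa_set n a b \<inter> gen_set n a b"
  obtain x y where xy: "p = (x, y)" by (cases p)
  obtain k where k: "x < y" "x = a + k * n" using p xy by (auto simp: gen_set_def)
  then have "\<not> b + k * n \<le> y" using p ab unfolding xy kappa_set_def by auto
  then show "p \<in> gen_cover_set n a b" using k by (auto simp: gen_cover_set_def xy)
next
  fix p assume p: "p \<in> gen_cover_set n a b"
  obtain x y where xy: "p = (x, y)" by (cases p)
  obtain k where k: "x < y" "x = a + k * n" "y < b + k * n"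
    using p xy by (auto simp: gen_cover_set_def)
  have "\<not> (a + l * n \<le> x \<and> x < b + l * n \<and> b + l * n \<le> y)" for l
  proof
    assume l: "a + l * n \<le> x \<and> x < b + l * n \<and> b + l * n \<le> y"
    then have "l * n < k * n" using k by linarith
    then have "l < k" using n2 by (simp add: mult_less_cancel_right)
    then show False using step[of l k] l k ab by auto
  qed
  then have "p \<in> kappa_set n a b" using k by (auto simp: kappa_set_def xy)
  then show "p \<in> kappa_set n a b \<inter> gen_set n a b" using p gen_cover_set_psubset by blast
qed

text \<open>Suppose \<open>(x, y)\<close> lies outside, with \<open>a \<le> x < b \<le> y\<close> up to translation. Since \<open>(a, x)\<close>
  is an inversion or \<open>a = x\<close>, and \<open>(x, b)\<close> is an inversion, \<open>(a, b)\<close> is one too, so the meet with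
  the generator is too large.\<close>

lemma kappa_set_greatest:
  assumes E: "E \<in> tamari_sets n" and EJ: "E \<inter> gen_set n a b = gen_cover_set n a b"
  shows "E \<subseteq> kappa_set n a b"
proof clarify
  fix x y assume xy: "(x, y) \<in> E"
  have "\<not> (a + k * n \<le> x \<and> x < b + k * n \<and> b + k * n \<le> y)" for k
  proof
    assume k: "a + k * n \<le> x \<and> x < b + k * n \<and> b + k * n \<le> y"
    then have x: "(x, b + k * n) \<in> E" using tamari_initial[OF E xy] by blast
    have "(a + k * n, b + k * n) \<in> E"
    proof (cases "x = a + k * n")
      case False
      then have "(a + k * n, x) \<in> gen_cover_set n a b" using k by (auto simp: gen_cover_set_def)
      then show ?thesis using EJ x tamari_trans[OF E] by blast
    qed (use x in simp)
    then have "(a, b) \<in> E" using tamari_shift_iff[OF E] by blast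
    moreover have "(a, b) \<notin> gen_cover_set n a b" by (auto simp: gen_cover_set_def)
    ultimately show False using gen_set_self EJ by blast
  qed
  then show "(x, y) \<in> kappa_set n a b" using tamari_lessD[OF E xy] by (auto simp: kappa_set_def)
qed

lemma order_of_gen_set_join_irreducible:
  "order_of (gen_set n a b) \<in> join_irreducibles (CTam n)"
  unfolding CTam_eq
  by (rule join_irreducible_if_lower_cover[OF subset_refl has_joins_tamari_sets gen_set_tamari
        gen_cover_set_tamari gen_cover_set_psubset below_gen_set])

lemma kappa_CTam: "kappa (CTam n) (order_of (gen_set n a b)) = order_of (kappa_set n a b)"
  unfolding CTam_eq
  by (rule kappa_tamari_poset[OF subset_refl gen_set_tamari gen_cover_set_tamari
        gen_cover_set_psubset below_gen_set tamari_Int kappa_set_tamari kappa_set_Int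
        kappa_set_greatest])
    (simp_all add: gen_set_tamari)

lemma subset_gen_set_real:
  assumes "b < a + n" "E \<in> tamari_sets n" "E \<subseteq> gen_set n a b"
  shows "E \<in> real_tamari_sets n"
proof -
  have "(x, x + n) \<notin> gen_set n a b" for x using assms(1) by (auto simp: gen_set_def)
  then show ?thesis using assms by (auto simp: real_tamari_sets_def)
qed

text \<open>A generator with \<open>b < a + n\<close> has no waning class, so neither has anything below it. Its
  meets in the affine lattice are therefore still intersections, and the characterization of
  \<open>\<kappa>\<close> only has to be restricted to real elements.\<close>

lemma kappa_ATam:
  assumes b: "b < a + n"
  shows "kappa (ATam n) (order_of (gen_set n a b)) = order_of (real_part n (kappa_set n a b))"
  unfolding ATam_eq[OF n2]
proof (rule kappa_tamari_poset)
  have J: "gen_set n a b \<in> real_tamari_sets n"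
    by (rule subset_gen_set_real[OF b gen_set_tamari subset_refl])
  have J': "gen_cover_set n a b \<in> real_tamari_sets n"
    using subset_gen_set_real[OF b gen_cover_set_tamari] gen_cover_set_psubset by blast
  show "real_tamari_sets n \<subseteq> tamari_sets n" using real_tamariD by blast
  show "gen_set n a b \<in> real_tamari_sets n" by (rule J)
  show "gen_cover_set n a b \<in> real_tamari_sets n" by (rule J')
  show "E \<subseteq> gen_cover_set n a b" if "E \<in> real_tamari_sets n" "E \<subset> gen_set n a b" for E
    using below_gen_set that real_tamariD by blast
  show "E \<inter> gen_set n a b \<in> real_tamari_sets n" if "E \<in> real_tamari_sets n" for E
    using subset_gen_set_real[OF b tamari_Int[OF real_tamariD[OF that] gen_set_tamari]] by blast
  show "real_part n (kappa_set n a b) \<in> real_tamari_sets n"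
    by (rule real_part_real[OF kappa_set_tamari])
  show "real_part n (kappa_set n a b) \<inter> gen_set n a b = gen_cover_set n a b"
    using kappa_set_Int real_part_subset[of n "kappa_set n a b"] J'
      real_part_greatest[OF J', of "kappa_set n a b"] by blast
  show "E \<subseteq> real_part n (kappa_set n a b)"
    if "E \<in> real_tamari_sets n" "E \<inter> gen_set n a b = gen_cover_set n a b" for E
    using real_part_greatest[OF that(1)] kappa_set_greatest[OF real_tamariD[OF that(1)] that(2)] by blast
qed (rule gen_cover_set_psubset)

end

end

section \<open>Windows\<close>

lemma order_of_shift:
  assumes "E \<in> tamari_sets n"
  shows "(x + k * n, y + k * n) \<in> order_of E \<longleftrightarrow> (x, y) \<in> order_of E"
  by (simp add: order_of_def tamari_shift_iff[OF assms])

lemma waxing_window_hits: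
  assumes "y \<in> set as"
  shows "\<exists>i. window_seq n (Waxing as) i = y + k * n"
proof -
  obtain r where r: "r < length as" "as ! r = y" using assms by (auto simp: in_set_conv_nth)
  moreover from r have "int (length as) \<noteq> 0" by linarith
  ultimately have "window_seq n (Waxing as) (int r + int (length as) * k) = y + k * n" by simp
  then show ?thesis ..
qed

lemma waxing_window_ordered:
  assumes E: "E \<in> tamari_sets n" and ne: "as \<noteq> []"
    and sorted: "sorted_wrt (\<lambda>x y. (x, y) \<in> order_of E) as"
    and next_window: "\<And>x y k. x \<in> set as \<Longrightarrow> y \<in> set as \<Longrightarrow> 0 < k \<Longrightarrow> (x, y + k * n) \<in> order_of E"
    and "i \<le> j"
  shows "(window_seq n (Waxing as) i, window_seq n (Waxing as) j) \<in> order_of E"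
proof -
  let ?l = "int (length as)"
  have l: "0 < ?l" using ne by simp
  define r s where "r = nat (i mod ?l)" and "s = nat (j mod ?l)"
  have rs: "r < length as" "s < length as" using l by (simp_all add: r_def s_def nat_less_iff)
  have ij: "window_seq n (Waxing as) i = as ! r + (i div ?l) * n"
      "window_seq n (Waxing as) j = as ! s + (j div ?l) * n"
    by (simp_all add: r_def s_def mult.commute)
  have "i div ?l \<le> j div ?l" using \<open>i \<le> j\<close> l by (rule zdiv_mono1)
  then consider (same) "i div ?l = j div ?l" | (later) "0 < j div ?l - i div ?l" by linarith
  then have "(as ! r, as ! s + (j div ?l - i div ?l) * n) \<in> order_of E"
  proof cases
    case same
    have "i mod ?l \<le> j mod ?l"
      using same \<open>i \<le> j\<close> by (simp add: minus_div_mult_eq_mod[symmetric])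
    then have "r \<le> s" by (simp add: r_def s_def nat_mono)
    then have "(as ! r, as ! s) \<in> order_of E"
      using sorted_wrt_nth_less[OF sorted, of r s] rs by (cases "r = s") (auto simp: order_of_def)
    then show ?thesis using same by simp
  next
    case later
    then show ?thesis using next_window rs by simp
  qed
  then show ?thesis
    unfolding ij using order_of_shift[OF E, of "as ! r" "i div ?l" "as ! s + (j div ?l - i div ?l) * n"]
    by (simp add: left_diff_distrib)
qed

text \<open>Inclusion is enough, because no total relation on the integers is properly contained in an
  antisymmetric one. So it only has to be checked that every integer occurs in the windows.\<close>

lemma tito_of_windows_eqI:
  assumes E: "E \<in> tamari_sets n"
    and sub: "tito_of_windows n ws \<subseteq> order_of E"
    and hits: "\<And>x. \<exists>p<length ws. \<exists>i. window_seq n (ws ! p) i = x"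
  shows "tito_of_windows n ws = order_of E"
proof (intro equalityI sub subsetI)
  have total: "(x, y) \<in> tito_of_windows n ws \<or> (y, x) \<in> tito_of_windows n ws" for x y
  proof -
    obtain p i where p: "p < length ws" "window_seq n (ws ! p) i = x" using hits by blast
    obtain q j where q: "q < length ws" "window_seq n (ws ! q) j = y" using hits by blast
    have "p < q \<or> p = q \<and> i \<le> j \<or> q < p \<or> q = p \<and> j \<le> i" by linarith
    then show ?thesis unfolding tito_of_windows_def using p q by blast
  qed
  fix u assume u: "u \<in> order_of E"
  obtain x y where xy: "u = (x, y)" by (cases u)
  have "antisym (order_of E)" using linear_order_of[OF E] by (simp add: order_on_defs)
  then show "u \<in> tito_of_windows n ws"
    using total[of x y] sub u xy by (auto dest: antisymD)
qed

context
  fixes n a b :: int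
  assumes n2: "2 \<le> n" and ab: "a < b" "b \<le> a + n"
begin

lemma j_elt_eq: "j_elt n a b = order_of (gen_set n a b)"
proof (cases "b < a + n")
  case True
  let ?us = "removeAll a [b + 1 - n..b]"
  let ?as = "?us @ [a]"
  have J: "gen_set n a b \<in> tamari_sets n" by (rule gen_set_tamari[OF n2 ab])
  have set_as: "set ?as = {b + 1 - n..b}" using True ab by auto
  have small: "l = 0" if "x \<in> {b + 1 - n..b}" "x = a + l * n" for x l
  proof (rule small_multiple[OF n2])
    have "b + 1 - n \<le> a + l * n" "a + l * n \<le> b" using that by auto
    then show "- n < l * n" "l * n < n" using True ab by linarith+
  qed
  have "tito_of_windows n [Waxing ?as] = order_of (gen_set n a b)"
  proof (rule tito_of_windows_eqI[OF J])
    fix x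
    obtain k where k: "b + 1 - n \<le> x + k * n" "x + k * n < b + 1 - n + n"
      using ex_translate[OF n2] by blast
    then have "x + k * n \<in> set ?as" unfolding set_as by simp
    from waxing_window_hits[OF this, of n "- k"]
    show "\<exists>p<length [Waxing ?as]. \<exists>i. window_seq n ([Waxing ?as] ! p) i = x" by simp
  next
    have "sorted_wrt (\<lambda>x y. (x, y) \<in> order_of (gen_set n a b)) ?us"
    proof (rule sorted_wrt_mono_rel[of _ "(<)"])
      show "sorted_wrt (<) ?us" by (simp add: removeAll_filter_not_eq sorted_wrt_filter)
      fix x y assume "x \<in> set ?us" "y \<in> set ?us" "x < y"
      moreover from this have "x \<noteq> a + l * n" for l using small[of x l] by auto
      ultimately show "(x, y) \<in> order_of (gen_set n a b)" by (auto simp: order_of_def gen_set_def)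
    qed
    moreover have "(x, a) \<in> order_of (gen_set n a b)" if "x \<in> set ?us" for x
    proof (cases "a < x")
      case True
      then have "(a, x) \<in> gen_set n a b" using that by (auto simp: gen_set_def intro!: exI[of _ 0])
      then show ?thesis using True by (simp add: order_of_def)
    next
      case False
      then have "x < a" using that by auto
      moreover from this have "x \<noteq> a + l * n" for l using small[of x l] that by auto
      ultimately show ?thesis by (auto simp: order_of_def gen_set_def)
    qed
    ultimately have sorted: "sorted_wrt (\<lambda>x y. (x, y) \<in> order_of (gen_set n a b)) ?as"
      by (simp add: sorted_wrt_append)
    have later: "(x, y + k * n) \<in> order_of (gen_set n a b)"
      if "x \<in> set ?as" "y \<in> set ?as" "0 < k" for x y k
    proof -
      have xy: "x \<in> {b + 1 - n..b}" "y \<in> {b + 1 - n..b}" using that unfolding set_as by auto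
      have "n \<le> k * n" using mult_less_imp_step[OF n2 \<open>0 < k\<close>] by simp
      then have "b < y + k * n" using xy(2) unfolding atLeastAtMost_iff by linarith
      then show ?thesis using xy True small[of x] by (auto simp: order_of_def gen_set_def)
    qed
    show "tito_of_windows n [Waxing ?as] \<subseteq> order_of (gen_set n a b)"
      using waxing_window_ordered[OF J _ sorted later]
      by (auto simp: tito_of_windows_def simp del: window_seq.simps)
  qed
  then show ?thesis using True by (simp add: j_elt_def)
next
  case False
  then have b: "b = a + n" using ab by simp
  let ?as = "[a - n + 1..a - 1]"
  have J: "gen_set n a b \<in> tamari_sets n" by (rule gen_set_tamari[OF n2 ab])
  have mem: "(x, y) \<in> gen_set n a b \<longleftrightarrow> x < y \<and> (\<exists>k. x = a + k * n)" for x y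
    using b by (auto simp: gen_set_def)
  have waning: "window_seq n (Waning [a]) i = a + (- i) * n" for i by simp
  have other: "x \<noteq> a + k * n" if "x \<in> set ?as" for x k
  proof
    assume x: "x = a + k * n"
    have range: "a - n + 1 \<le> x" "x \<le> a - 1" using that by auto
    have "k = 0" by (rule small_multiple[OF n2]) (use x range in linarith)+
    then show False using x range by simp
  qed
  have other_seq: "window_seq n (Waxing ?as) i \<noteq> a + k * n" for i k
  proof -
    let ?r = "nat (i mod int (length ?as))"
    have "?r < length ?as" using n2 by (simp add: nat_less_iff)
    then have "?as ! ?r \<in> set ?as" by (rule nth_mem)
    from other[OF this, of "k - i div int (length ?as)"] show ?thesis
      by (simp add: algebra_simps)
  qed
  have ordered: "(x, y) \<in> order_of (gen_set n a b)" if "x < y" "\<And>k. x \<noteq> a + k * n" for x y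
    using that by (auto simp: order_of_def mem)
  have "sorted_wrt (\<lambda>x y. (x, y) \<in> order_of (gen_set n a b)) ?as"
    by (rule sorted_wrt_mono_rel[of _ "(<)"]) (use ordered other in auto)
  note waxing = waxing_window_ordered[OF J _ this]
  have later: "(x, y + k * n) \<in> order_of (gen_set n a b)"
    if "x \<in> set ?as" "y \<in> set ?as" "0 < k" for x y k
  proof -
    have "n \<le> k * n" using mult_less_imp_step[OF n2 \<open>0 < k\<close>] by simp
    moreover have "x < a" "a - n < y" using that by auto
    ultimately have "x < y + k * n" by linarith
    then show ?thesis using ordered other[OF that(1)] by blast
  qed
  have between: "(window_seq n (Waxing ?as) i, window_seq n (Waning [a]) j) \<in> order_of (gen_set n a b)" for i j
    unfolding waning
  proof (cases "window_seq n (Waxing ?as) i" "a + (- j) * n" rule: linorder_cases)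
    case less
    then show "(window_seq n (Waxing ?as) i, a + (- j) * n) \<in> order_of (gen_set n a b)"
      using other_seq[of i] by (rule ordered)
  next
    case equal
    then show "(window_seq n (Waxing ?as) i, a + (- j) * n) \<in> order_of (gen_set n a b)"
      using other_seq[of i "- j"] by contradiction
  next
    case greater
    then have "(a + (- j) * n, window_seq n (Waxing ?as) i) \<in> gen_set n a b"
      unfolding mem by blast
    then show "(window_seq n (Waxing ?as) i, a + (- j) * n) \<in> order_of (gen_set n a b)"
      using greater unfolding order_of_def by blast
  qed
  have within: "(window_seq n (Waning [a]) i, window_seq n (Waning [a]) j) \<in> order_of (gen_set n a b)"
    if "i \<le> j" for i j
  proof (cases "i = j")
    case False
    then have "(- j) * n < (- i) * n" using that n2 by (intro mult_strict_right_mono) auto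
    then have less: "a + (- j) * n < a + (- i) * n" by (rule add_strict_left_mono)
    then have "(a + (- j) * n, a + (- i) * n) \<in> gen_set n a b" unfolding mem by blast
    then show ?thesis unfolding waning order_of_def using less by blast
  qed (simp add: order_of_def)
  have "tito_of_windows n [Waxing ?as, Waning [a]] = order_of (gen_set n a b)"
  proof (rule tito_of_windows_eqI[OF J])
    fix x
    obtain k where k: "a - n + 1 \<le> x + k * n" "x + k * n < a - n + 1 + n"
      using ex_translate[OF n2] by blast
    show "\<exists>p<length [Waxing ?as, Waning [a]]. \<exists>i. window_seq n ([Waxing ?as, Waning [a]] ! p) i = x"
    proof (cases "x + k * n = a")
      case True
      then have "window_seq n (Waning [a]) k = x" unfolding waning by (simp add: algebra_simps)
      then show ?thesis by (intro exI[of _ 1]) auto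
    next
      case False
      then have "x + k * n \<in> set ?as" using k by auto
      from waxing_window_hits[OF this, of n "- k"] show ?thesis by (intro exI[of _ 0]) simp
    qed
  next
    have two: "p = 0 \<or> p = 1" if "p < length [Waxing ?as, Waning [a]]" for p using that by auto
    have "?as \<noteq> []" using n2 by auto
    show "tito_of_windows n [Waxing ?as, Waning [a]] \<subseteq> order_of (gen_set n a b)"
    proof
      fix u assume "u \<in> tito_of_windows n [Waxing ?as, Waning [a]]"
      then obtain p q i j where u: "u = (window_seq n ([Waxing ?as, Waning [a]] ! p) i,
            window_seq n ([Waxing ?as, Waning [a]] ! q) j)"
          "p = 0 \<or> p = 1" "q = 0 \<or> q = 1" "p < q \<or> p = q \<and> i \<le> j"
        using two unfolding tito_of_windows_def by blast
      then show "u \<in> order_of (gen_set n a b)"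
        using waxing[OF \<open>?as \<noteq> []\<close> later] within between
        by (auto simp del: window_seq.simps)
    qed
  qed
  then show ?thesis using False by (simp add: j_elt_def)
qed

end

section \<open>The factorizations\<close>

lemma le_CTam:
  "E \<in> tamari_sets n \<Longrightarrow> F \<in> tamari_sets n \<Longrightarrow>
    order_of E \<sqsubseteq>\<^bsub>CTam n\<^esub> order_of F \<longleftrightarrow> E \<subseteq> F"
  by (simp add: CTam_eq le_tamari_poset)

lemma le_ATam: "x \<sqsubseteq>\<^bsub>ATam n\<^esub> y \<longleftrightarrow> x \<sqsubseteq>\<^bsub>CTam n\<^esub> y"
  by (simp add: ATam_def CTam_def tito_poset_def)

lemma reflection_index_iff: "(x, y) \<in> reflection_index n a b \<longleftrightarrow> (\<exists>k. x = a + k * n \<and> y = b + k * n)"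
  by (auto simp: reflection_index_def)

lemma ex_representatives_iff:
  assumes inv: "\<And>x y z w t. P (x + t) (y + t) (z + t) (w + t) \<longleftrightarrow> P x y z w"
  shows "(\<exists>a' b' c' d'. (a', b') \<in> reflection_index n a b \<and> (c', d') \<in> reflection_index n c d \<and>
      P a' b' c' d') \<longleftrightarrow> (\<exists>k. P a b (c + k * n) (d + k * n))"
    (is "?l \<longleftrightarrow> ?r")
proof
  assume ?l
  then obtain k l where "P (a + k * n) (b + k * n) (c + l * n) (d + l * n)"
    unfolding reflection_index_iff by blast
  then have "P a b (c + (l - k) * n) (d + (l - k) * n)"
    using inv[of a "k * n" b "c + (l - k) * n" "d + (l - k) * n"] by (simp add: algebra_simps)
  then show ?r ..
next
  assume ?r
  moreover have "(a, b) \<in> reflection_index n a b" by (auto simp: reflection_index_iff intro: exI[of _ 0])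
  ultimately show ?l unfolding reflection_index_iff[of _ _ n c d] by blast
qed

lemma gen_set_mem_iff:
  assumes "a < b" "b \<le> a + n"
  shows "(a, b) \<in> gen_set n c d \<longleftrightarrow> (\<exists>k. a = c + k * n \<and> b \<le> d + k * n)"
  using assms by (auto simp: gen_set_def)

lemma kappa_set_subsetI:
  assumes k: "b = d + k * n" "c + k * n \<le> a"
  shows "kappa_set n c d \<subseteq> kappa_set n a b"
proof clarify
  fix x y assume xy: "(x, y) \<in> kappa_set n c d"
  have "\<not> (a + l * n \<le> x \<and> x < b + l * n \<and> b + l * n \<le> y)" for l
  proof -
    have "\<not> (c + (k + l) * n \<le> x \<and> x < d + (k + l) * n \<and> d + (k + l) * n \<le> y)"
      using xy unfolding kappa_set_def by blast
    then show ?thesis using k by (auto simp: algebra_simps)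
  qed
  then show "(x, y) \<in> kappa_set n a b" using xy by (simp add: kappa_set_def)
qed

lemma not_in_kappa_set:
  assumes "a \<le> x" "x < b"
  shows "(x, b) \<notin> kappa_set n a b"
  using assms by (auto simp: kappa_set_def intro: exI[of _ 0])

context
  fixes n :: int
  assumes n2: "2 \<le> n"
begin

text \<open>The pair \<open>(b - 1, b)\<close> is missing only if a translate of \<open>d\<close> equals \<open>b\<close>, and \<open>(a, b)\<close>
  only if some translate of the interval from \<open>c\<close> to \<open>d\<close> has \<open>c \<le> a < d \<le> b\<close>. As
  \<open>b - a \<le> n\<close>, both translates of \<open>d\<close> lie above \<open>a\<close> and up to \<open>b\<close>, so they coincide.\<close>

lemma kappa_set_subsetD:
  assumes ab: "a < b" "b \<le> a + n"
    and notin: "(b - 1, b) \<notin> kappa_set n c d" "(a, b) \<notin> kappa_set n c d"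
  shows "\<exists>k. b = d + k * n \<and> c + k * n \<le> a"
proof -
  obtain k where k: "c + k * n \<le> b - 1" "b - 1 < d + k * n" "d + k * n \<le> b"
    using notin(1) by (auto simp: kappa_set_def)
  obtain l where l: "c + l * n \<le> a" "a < d + l * n" "d + l * n \<le> b"
    using notin(2) ab by (auto simp: kappa_set_def)
  have "(k - l) * n = 0"
    using small_multiple[OF n2, of "k - l"] k l ab by (simp add: left_diff_distrib)
  then have "k = l" using n2 by simp
  then have "b = d + l * n" using k l by simp
  then show ?thesis using l by blast
qed

lemma kappa_set_subset_iff:
  assumes ab: "a < b" "b \<le> a + n"
  shows "kappa_set n c d \<subseteq> kappa_set n a b \<longleftrightarrow> (\<exists>k. b = d + k * n \<and> c + k * n \<le> a)"
  using kappa_set_subsetI kappa_set_subsetD[OF ab, of c d]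
    not_in_kappa_set[of a "b - 1" b] not_in_kappa_set[of a a b] ab by fastforce

lemma real_part_kappa_set_subset_iff:
  assumes ab: "a < b" "b < a + n"
  shows "real_part n (kappa_set n c d) \<subseteq> real_part n (kappa_set n a b) \<longleftrightarrow>
    kappa_set n c d \<subseteq> kappa_set n a b"
proof
  assume sub: "real_part n (kappa_set n c d) \<subseteq> real_part n (kappa_set n a b)"
  have "(x, b) \<notin> kappa_set n c d" if "a \<le> x" "x < b" for x
  proof
    assume "(x, b) \<in> kappa_set n c d"
    then have "(x, b) \<in> real_part n (kappa_set n c d)" using that ab by (simp add: real_part_def)
    then show False using sub real_part_subset not_in_kappa_set[OF that] by blast
  qed
  then show "kappa_set n c d \<subseteq> kappa_set n a b"
    using kappa_set_subsetD[of a b c d] ab kappa_set_subsetI by force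
qed (rule real_part_mono)

text \<open>A real element is the join of the generators of length less than \<open>n\<close> below it: a longer
  inversion \<open>(x, y)\<close> comes with a second waning class, represented by some \<open>z\<close> between \<open>x\<close> and
  \<open>x + n\<close>, and the short inversions \<open>(x, z)\<close> and \<open>(z, x + n)\<close> already force \<open>x\<close> to wane.
  Restricting the left end to one period makes the set of generators finite.\<close>

lemma join_irreducible_ATam_gen_set:
  assumes R: "R \<in> join_irreducibles (ATam n)"
  shows "\<exists>a b. a < b \<and> b < a + n \<and> R = order_of (gen_set n a b)"
proof -
  let ?I = "SIGMA a:{0..<n}. {a<..<a + n}"
  let ?G = "(\<lambda>(a, b). gen_set n a b) ` ?I"
  have sub: "real_tamari_sets n \<subseteq> tamari_sets n" using real_tamariD by blast
  obtain E where E: "E \<in> real_tamari_sets n" "R = order_of E"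
    using R by (auto simp: join_irreducibles_def ATam_eq[OF n2] carrier_tamari_poset[OF sub])
  have ET: "E \<in> tamari_sets n" using E real_tamariD by blast
  have "E \<in> ?G"
  proof (rule join_irreducible_in_generators[OF sub has_joins_real_tamari_sets[OF n2] empty_real_tamari])
    show "finite ?G" by (intro finite_imageI finite_SigmaI) auto
    show "?G \<subseteq> real_tamari_sets n"
      using subset_gen_set_real[OF n2 _ _ _ gen_set_tamari[OF n2] subset_refl] by auto
    show "E \<in> real_tamari_sets n" by (rule E)
    show "order_of E \<in> join_irreducibles (tamari_poset n (real_tamari_sets n))"
      using R E by (simp add: ATam_eq[OF n2])
    fix V assume V: "V \<in> real_tamari_sets n" and GV: "\<And>G. G \<in> ?G \<Longrightarrow> G \<subseteq> E \<Longrightarrow> G \<subseteq> V"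
    have VT: "V \<in> tamari_sets n" using V real_tamariD by blast
    have short: "(x, y) \<in> V" if xy: "(x, y) \<in> E" "y < x + n" for x y
    proof -
      obtain k where k: "0 \<le> x + k * n" "x + k * n < 0 + n" using ex_translate[OF n2] by blast
      have less: "x < y" using tamari_lessD[OF ET xy(1)] .
      then have "gen_set n (x + k * n) (y + k * n) \<in> ?G" using k xy by force
      moreover have "(x + k * n, y + k * n) \<in> E" using xy tamari_shift_iff[OF ET] by blast
      then have "gen_set n (x + k * n) (y + k * n) \<subseteq> E"
        using gen_set_least[OF n2 _ _ ET] less xy by simp
      ultimately have "gen_set n (x + k * n) (y + k * n) \<subseteq> V" by (rule GV)
      then have "(x + k * n, y + k * n) \<in> V" using gen_set_self[OF n2] less xy by auto
      then show ?thesis using tamari_shift_iff[OF VT] by blast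
    qed
    show "E \<subseteq> V"
    proof clarify
      fix x y assume xy: "(x, y) \<in> E"
      have less: "x < y" using tamari_lessD[OF ET xy] .
      show "(x, y) \<in> V"
      proof (cases "y < x + n")
        case False
        then have "(x, x + n) \<in> E" using tamari_initial[OF ET xy, of "x + n"] n2 by simp
        then obtain z' where z': "(z', z' + n) \<in> E" "\<forall>k. z' \<noteq> x + k * n"
          using E by (auto simp: real_tamari_sets_def)
        obtain k where k: "x \<le> z' + k * n" "z' + k * n < x + n" using ex_translate[OF n2] by blast
        define z where "z = z' + k * n"
        have "z \<noteq> x" using z'(2)[rule_format, of "- k"] by (auto simp: z_def)
        then have z: "x < z" "z < x + n" using k by (auto simp: z_def)
        have "(z, z + n) \<in> E"
          using z'(1) tamari_shift_iff[OF ET, of z' k "z' + n"] by (simp add: z_def algebra_simps)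
        then have "(z, x + n) \<in> E" using tamari_initial[OF ET] z by simp
        then have "(z, x + n) \<in> V" using short z by simp
        moreover have "(x, z) \<in> V" using short tamari_initial[OF ET xy] z False by simp
        ultimately have "(x, x + n) \<in> V" using tamari_trans[OF VT] by blast
        then show ?thesis using tamari_waning[OF n2 VT] less by blast
      qed (use short xy in blast)
    qed
  qed
  then show ?thesis using E by force
qed

end

theorem theorem5p5:
  fixes n :: int
  assumes "n \<ge> 2"
  shows
    "(\<forall>a b c d. a < b \<and> c < d \<and> b - a \<le> n \<and> d - c \<le> n \<longrightarrow>
        ((j_elt n c d, j_elt n a b) \<in> ftfsdl_onto (CTam n) \<longleftrightarrow>
           (\<exists>a' b' c' d'. (a', b') \<in> reflection_index n a b \<and> (c', d') \<in> reflection_index n c d \<and>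
              a' = c' \<and> b' \<le> d')) \<and>
        ((j_elt n a b, j_elt n c d) \<in> ftfsdl_into (CTam n) \<longleftrightarrow>
           (\<exists>a' b' c' d'. (a', b') \<in> reflection_index n a b \<and> (c', d') \<in> reflection_index n c d \<and>
              b' = d' \<and> a' \<ge> c')) \<and>
        ((j_elt n a b, j_elt n c d) \<in> ftfsdl_to (CTam n) \<longleftrightarrow>
           (\<exists>a' b' c' d'. (a', b') \<in> reflection_index n a b \<and> (c', d') \<in> reflection_index n c d \<and>
              c' \<le> a' \<and> a' < d' \<and> d' \<le> b'))) \<and>
     ftfsdl_onto (ATam n) = Restr (ftfsdl_onto (CTam n)) (join_irreducibles (ATam n)) \<and>
     ftfsdl_into (ATam n) = Restr (ftfsdl_into (CTam n)) (join_irreducibles (ATam n)) \<and>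
     ftfsdl_to (ATam n) = Restr (ftfsdl_to (CTam n)) (join_irreducibles (ATam n))"
proof -
  have rep: "(\<exists>a' b' c' d'. (a', b') \<in> reflection_index n a b \<and> (c', d') \<in> reflection_index n c d \<and>
        a' = c' \<and> b' \<le> d') \<longleftrightarrow> (\<exists>k. a = c + k * n \<and> b \<le> d + k * n)"
      "(\<exists>a' b' c' d'. (a', b') \<in> reflection_index n a b \<and> (c', d') \<in> reflection_index n c d \<and>
        b' = d' \<and> a' \<ge> c') \<longleftrightarrow> (\<exists>k. b = d + k * n \<and> c + k * n \<le> a)"
      "(\<exists>a' b' c' d'. (a', b') \<in> reflection_index n a b \<and> (c', d') \<in> reflection_index n c d \<and>
        c' \<le> a' \<and> a' < d' \<and> d' \<le> b') \<longleftrightarrow>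
        (\<exists>k. c + k * n \<le> a \<and> a < d + k * n \<and> d + k * n \<le> b)" for a b c d
    using ex_representatives_iff[of "\<lambda>a b c d. a = c \<and> b \<le> d" n a b c d]
      ex_representatives_iff[of "\<lambda>a b c d. b = d \<and> c \<le> a" n a b c d]
      ex_representatives_iff[of "\<lambda>a b c d. c \<le> a \<and> a < d \<and> d \<le> b" n a b c d]
    by simp_all
  have CTam: "((j_elt n c d, j_elt n a b) \<in> ftfsdl_onto (CTam n) \<longleftrightarrow>
          (\<exists>k. a = c + k * n \<and> b \<le> d + k * n)) \<and>
        ((j_elt n a b, j_elt n c d) \<in> ftfsdl_into (CTam n) \<longleftrightarrow>
          (\<exists>k. b = d + k * n \<and> c + k * n \<le> a)) \<and>
        ((j_elt n a b, j_elt n c d) \<in> ftfsdl_to (CTam n) \<longleftrightarrow>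
          (\<exists>k. c + k * n \<le> a \<and> a < d + k * n \<and> d + k * n \<le> b))"
    if "a < b \<and> c < d \<and> b - a \<le> n \<and> d - c \<le> n" for a b c d
  proof -
    have ab: "a < b" "b \<le> a + n" and cd: "c < d" "d \<le> c + n" using that by auto
    have "(a, b) \<notin> kappa_set n c d \<longleftrightarrow> (\<exists>k. c + k * n \<le> a \<and> a < d + k * n \<and> d + k * n \<le> b)"
      using ab by (auto simp: kappa_set_def)
    then show ?thesis
      using order_of_gen_set_join_irreducible[OF assms ab] order_of_gen_set_join_irreducible[OF assms cd]
      by (simp add: ftfsdl_onto_def ftfsdl_into_def ftfsdl_to_def j_elt_eq[OF assms ab] j_elt_eq[OF assms cd]
          kappa_CTam[OF assms ab] kappa_CTam[OF assms cd] le_CTam gen_set_tamari[OF assms ab]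
          gen_set_tamari[OF assms cd] kappa_set_tamari
          gen_set_subset_iff[OF assms ab] gen_set_mem_iff[OF ab] kappa_set_subset_iff[OF assms ab])
  qed
  have kappa: "kappa (ATam n) R2 \<sqsubseteq>\<^bsub>ATam n\<^esub> kappa (ATam n) R1 \<longleftrightarrow>
        kappa (CTam n) R2 \<sqsubseteq>\<^bsub>CTam n\<^esub> kappa (CTam n) R1"
      "R1 \<sqsubseteq>\<^bsub>ATam n\<^esub> kappa (ATam n) R2 \<longleftrightarrow> R1 \<sqsubseteq>\<^bsub>CTam n\<^esub> kappa (CTam n) R2"
    if R: "R1 \<in> join_irreducibles (ATam n)" "R2 \<in> join_irreducibles (ATam n)" for R1 R2
  proof -
    obtain a b where ab: "a < b" "b < a + n" and R1: "R1 = order_of (gen_set n a b)"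
      using join_irreducible_ATam_gen_set[OF assms R(1)] by blast
    obtain c d where cd: "c < d" "d < c + n" and R2: "R2 = order_of (gen_set n c d)"
      using join_irreducible_ATam_gen_set[OF assms R(2)] by blast
    have ab': "b \<le> a + n" and cd': "d \<le> c + n" using ab cd by auto
    note K = kappa_set_tamari[of n a b] kappa_set_tamari[of n c d]
    note real_K = K[THEN real_part_real[OF assms], THEN real_tamariD]
    note J = gen_set_tamari[OF assms ab(1) ab']
    have real_J: "gen_set n a b \<in> real_tamari_sets n"
      by (rule subset_gen_set_real[OF assms ab(1) ab' ab(2) J subset_refl])
    have J_sub: "gen_set n a b \<subseteq> real_part n (kappa_set n c d) \<longleftrightarrow> gen_set n a b \<subseteq> kappa_set n c d"
      using real_part_greatest[OF assms real_J] real_part_subset by blast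
    note kappas = kappa_CTam[OF assms ab(1) ab'] kappa_CTam[OF assms cd(1) cd']
      kappa_ATam[OF assms ab(1) ab' ab(2)] kappa_ATam[OF assms cd(1) cd' cd(2)]
    show "kappa (ATam n) R2 \<sqsubseteq>\<^bsub>ATam n\<^esub> kappa (ATam n) R1 \<longleftrightarrow>
        kappa (CTam n) R2 \<sqsubseteq>\<^bsub>CTam n\<^esub> kappa (CTam n) R1"
      by (simp add: R1 R2 kappas le_ATam le_CTam K real_K real_part_kappa_set_subset_iff[OF assms ab])
    show "R1 \<sqsubseteq>\<^bsub>ATam n\<^esub> kappa (ATam n) R2 \<longleftrightarrow> R1 \<sqsubseteq>\<^bsub>CTam n\<^esub> kappa (CTam n) R2"
      by (simp add: R1 R2 kappas le_ATam le_CTam K real_K J J_sub)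
  qed
  have "join_irreducibles (ATam n) \<subseteq> join_irreducibles (CTam n)"
  proof
    fix R assume "R \<in> join_irreducibles (ATam n)"
    then obtain a b where "a < b" "b < a + n" "R = order_of (gen_set n a b)"
      using join_irreducible_ATam_gen_set[OF assms] by blast
    then show "R \<in> join_irreducibles (CTam n)"
      using order_of_gen_set_join_irreducible[OF assms, of a b] by simp
  qed
  then have "ftfsdl_onto (ATam n) = Restr (ftfsdl_onto (CTam n)) (join_irreducibles (ATam n))"
      "ftfsdl_into (ATam n) = Restr (ftfsdl_into (CTam n)) (join_irreducibles (ATam n))"
      "ftfsdl_to (ATam n) = Restr (ftfsdl_to (CTam n)) (join_irreducibles (ATam n))"
    using kappa le_ATam by (auto simp: ftfsdl_onto_def ftfsdl_into_def ftfsdl_to_def)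
  then show ?thesis unfolding rep using CTam by simp
qed

end
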